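(* Let $n,d\ge 1$, let $x\in\mathbb{R}^d$, and let $\mathbb{W}^x(\mathbf t)=W^x(|B^{(1)}(t_1)|,\ldots,|B^{(n)}(t_n)|)$, $\mathbf t\in\mathbb{R}_+^n$, be the $n$-parameter $\mathbb{R}^d$-valued Brownian-time Brownian sheet started at $x$. Let $f:\mathbb{R}^d\to\mathbb{R}$ be bounded and measurable such that all second order partial derivatives $\partial^2_{x_k,x_l}f$, $1\le k,l\le d$, are bounded and Hölder continuous with exponent $0<\alpha\le 1$. For $(\mathbf t,x)\in\mathbb{R}_+^n\times\mathbb{R}^d$ and $j\in\mathbb{N}_n=\{1,\ldots,n\}$ set $$u(\mathbf t,x)=\mathbb{E}\left[f(\mathbb{W}^x(\mathbf t))\right],\qquad \mathscr V^{(j)}(\mathbf t,x)=\mathbb{E}\left[\Big(\prod_{i\in\mathbb{N}_n\setminus\{j\}}|B^{(i)}(t_i)|\Big) f(\mathbb{W}^x(\mathbf t))\right].$$ Then for every $j\in\mathbb{N}_n$ the family $\{u,\mathscr V^{(j)}\}$ solves $$\begin{cases} (a)\ \partial_{t_j}^{1/2}u=\frac{1}{\sqrt 8}\Delta_x\mathscr V^{(j)}; & \mathbf t\in(0,\infty)^n,\ x\in\mathbb{R}^d,\\ (b)\ u(\mathbf t,x)=f(x); & \mathbf t\in\partial\mathbb{R}_+^n,\ x\in\mathbb{R}^d,\\ (c)\ \mathscr V^{(j)}(\mathbf t,x)=0; & t_i=0\text{ for some } i\in\mathbb{N}_n\setminus\{j\},\ x\in\mathbb{R}^d,\\ (d)\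 \mathscr V^{(j)}(\mathbf t,x)=\Big[\prod_{i\in\mathbb{N}_n\setminus\{j\}}\sqrt{\tfrac{2}{\pi}}\,t_i^{1/2}\Big]f(x); & t_j=0,\ x\in\mathbb{R}^d. \end{cases}$$ In particular, if $n=1$, then $u=\mathscr V^{(1)}$ and the system reduces to $$\partial_t^{1/2}u=\frac{1}{\sqrt8}\Delta_x u\quad (t>0,\ x\in\mathbb{R}^d),\qquad u(0,x)=f(x)\quad(x\in\mathbb{R}^d).$$
   Context: $\mathbb{R}_+=[0,\infty)$, $\mathbf t=(t_1,\ldots,t_n)$, and $\partial\mathbb{R}_+^n$ is the set of $\mathbf t\in\mathbb{R}_+^n$ with at least one zero coordinate. Empty products equal $1$. $\Delta_x$ is the Laplacian in $x\in\mathbb{R}^d$. Brownian sheet: $W^0=(W^0_1,\ldots,W^0_d)$ is an $n$-parameter $\mathbb{R}^d$-valued Brownian sheet on a probability space $(\Omega,\mathscr F,\mathbb{P})$ with independent coordinates, vanishing on $\partial\mathbb{R}_+^n$, and $W^x=W^0+x$. For $\mathbf s\in(0,\infty)^n$, $W^x(\mathbf s)$ has density $y\mapsto (2\pi\prod_i s_i)^{-d/2}\exp\big(-|x-y|^2/(2\prod_i s_i)\big)$. Brownian-time Brownian sheet: $B^{(1)},\ldots,B^{(n)}$ are independent standard one-dimensional Brownian motions started at $0$, independent of $W^0$, and $\mathbb{W}^x(\mathbf t)=W^x(|B^{(1)}(t_1)|,\ldots,|B^{(n)}(t_n)|)$. Caputo fractional derivative of order $0<\beta<1$ in a time variable $t$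 (other variables held fixed), for functions $C^1$ in that variable: $\partial_t^\beta u(t)=\frac{1}{\Gamma(1-\beta)}\int_0^t \partial_s u(s)\,\frac{ds}{(t-s)^\beta}$. *)

theory Defs
  imports "HOL-Probability.Probability"
begin

section \<open>Time parameters\<close>

definition orthant :: "(real ^ 'n) set" where
  "orthant = {t. \<forall>i. 0 \<le> t $ i}"

definition open_orthant :: "(real ^ 'n) set" where
  "open_orthant = {t. \<forall>i. 0 < t $ i}"

definition orthant_boundary :: "(real ^ 'n) set" where
  "orthant_boundary = {t \<in> orthant. \<exists>i. t $ i = 0}"

definition vec_upd :: "real ^ 'n \<Rightarrow> 'n \<Rightarrow> real \<Rightarrow> real ^ 'n" where
  "vec_upd t j s = (\<chi> i. if i = j then s else t $ i)"


section \<open>Brownian motion and Brownian sheet\<close>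

text \<open>The sigma-algebra on \<open>space M\<close> generated by the random variables \<open>X t\<close>, \<open>t \<in> T\<close>.\<close>

definition process_sigma ::
  "'w measure \<Rightarrow> 'i set \<Rightarrow> ('i \<Rightarrow> 'w \<Rightarrow> 'b::topological_space) \<Rightarrow> 'w set set" where
  "process_sigma M T X =
     sets (vimage_algebra (space M) (\<lambda>\<omega>. \<lambda>t\<in>T. X t \<omega>) (Pi\<^sub>M T (\<lambda>_. borel)))"

text \<open>The law \<open>N(0, \<sigma>\<^sup>2)\<close>, including the degenerate case \<open>\<sigma> = 0\<close> (where
  \<^const>\<open>normal_density\<close> is not a probability density).\<close>

definition centred_gaussian :: "real \<Rightarrow> real measure" where
  "centred_gaussian \<sigma> =
     (if \<sigma> = 0 then return borel 0 else density lborel (\<lambda>x. ennreal (normal_density 0 \<sigma> x)))"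

definition standard_brownian_motion :: "'w measure \<Rightarrow> (real \<Rightarrow> 'w \<Rightarrow> real) \<Rightarrow> bool" where
  "standard_brownian_motion M B \<longleftrightarrow>
     prob_space M \<and>
     (\<forall>t\<ge>0. B t \<in> borel_measurable M) \<and>
     (\<forall>\<omega>\<in>space M. B 0 \<omega> = 0) \<and>
     (\<forall>\<omega>\<in>space M. continuous_on {0..} (\<lambda>t. B t \<omega>)) \<and>
     (\<forall>s t. 0 \<le> s \<and> s < t \<longrightarrow>
        distr M borel (\<lambda>\<omega>. B t \<omega> - B s \<omega>) = centred_gaussian (sqrt (t - s))) \<and>
     (\<forall>(\<tau> :: nat \<Rightarrow> real) m. 0 \<le> \<tau> 0 \<and> incseq \<tau> \<longrightarrow>
        prob_space.indep_vars M (\<lambda>_. borel) (\<lambda>i \<omega>. B (\<tau> (Suc i)) \<omega> - B (\<tau> i) \<omega>) {..<m})"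

text \<open>A real-valued Brownian sheet: a continuous centred Gaussian process on the orthant with
  covariance \<open>\<Prod>i. min (s\<^sub>i) (t\<^sub>i)\<close>. Continuity and vanishing on the boundary are required for
  every \<open>\<omega>\<close>, so that the sheet evaluated at a random time is a random variable without any
  completeness assumption on \<open>M\<close>.\<close>

definition real_brownian_sheet :: "'w measure \<Rightarrow> (real ^ 'n \<Rightarrow> 'w \<Rightarrow> real) \<Rightarrow> bool" where
  "real_brownian_sheet M W \<longleftrightarrow>
     prob_space M \<and>
     (\<forall>t\<in>orthant. W t \<in> borel_measurable M) \<and>
     (\<forall>\<omega>\<in>space M. \<forall>t\<in>orthant_boundary. W t \<omega> = 0) \<and>
     (\<forall>\<omega>\<in>space M. continuous_on orthant (\<lambda>t. W t \<omega>)) \<and>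
     (\<forall>T a. finite T \<and> T \<subseteq> orthant \<longrightarrow>
        (\<exists>\<sigma>\<ge>0. distr M borel (\<lambda>\<omega>. \<Sum>t\<in>T. a t * W t \<omega>) = centred_gaussian \<sigma>)) \<and>
     (\<forall>s\<in>orthant. \<forall>t\<in>orthant.
        integral\<^sup>L M (\<lambda>\<omega>. W s \<omega> * W t \<omega>) = (\<Prod>i\<in>UNIV. min (s $ i) (t $ i)))"

definition brownian_sheet :: "'w measure \<Rightarrow> (real ^ 'n \<Rightarrow> 'w \<Rightarrow> real ^ 'd) \<Rightarrow> bool" where
  "brownian_sheet M W \<longleftrightarrow>
     (\<forall>k. real_brownian_sheet M (\<lambda>t \<omega>. W t \<omega> $ k)) \<and>
     prob_space.indep_sets M (\<lambda>k. process_sigma M orthant (\<lambda>t \<omega>. W t \<omega> $ k)) UNIV"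


section \<open>Brownian-time Brownian sheet\<close>

text \<open>\<open>W\<close> is the sheet started at \<open>0\<close>; the starting point \<open>x\<close> is added in \<open>btbs\<close>.\<close>

definition btbs_processes ::
  "'w measure \<Rightarrow> (real ^ 'n \<Rightarrow> 'w \<Rightarrow> real ^ 'd) \<Rightarrow> ('n \<Rightarrow> real \<Rightarrow> 'w \<Rightarrow> real) \<Rightarrow> bool" where
  "btbs_processes M W B \<longleftrightarrow>
     prob_space M \<and>
     brownian_sheet M W \<and>
     (\<forall>i. standard_brownian_motion M (B i)) \<and>
     prob_space.indep_sets M (\<lambda>i. process_sigma M {0..} (B i)) UNIV \<and>
     prob_space.indep_set M (process_sigma M orthant W)
       (process_sigma M (UNIV \<times> {0..}) (\<lambda>(i, t). B i t))"

definition btbs ::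
  "(real ^ 'n \<Rightarrow> 'w \<Rightarrow> real ^ 'd) \<Rightarrow> ('n \<Rightarrow> real \<Rightarrow> 'w \<Rightarrow> real) \<Rightarrow> real ^ 'd \<Rightarrow> real ^ 'n \<Rightarrow> 'w \<Rightarrow> real ^ 'd"
  where "btbs W B x t \<omega> = x + W (\<chi> i. \<bar>B i (t $ i) \<omega>\<bar>) \<omega>"

definition btbs_u ::
  "'w measure \<Rightarrow> (real ^ 'n \<Rightarrow> 'w \<Rightarrow> real ^ 'd) \<Rightarrow> ('n \<Rightarrow> real \<Rightarrow> 'w \<Rightarrow> real) \<Rightarrow> (real ^ 'd \<Rightarrow> real)
     \<Rightarrow> real ^ 'n \<Rightarrow> real ^ 'd \<Rightarrow> real" where
  "btbs_u M W B f t x = integral\<^sup>L M (\<lambda>\<omega>. f (btbs W B x t \<omega>))"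

definition btbs_V ::
  "'w measure \<Rightarrow> (real ^ 'n \<Rightarrow> 'w \<Rightarrow> real ^ 'd) \<Rightarrow> ('n \<Rightarrow> real \<Rightarrow> 'w \<Rightarrow> real) \<Rightarrow> (real ^ 'd \<Rightarrow> real)
     \<Rightarrow> 'n \<Rightarrow> real ^ 'n \<Rightarrow> real ^ 'd \<Rightarrow> real" where
  "btbs_V M W B f j t x =
     integral\<^sup>L M (\<lambda>\<omega>. (\<Prod>i\<in>UNIV - {j}. \<bar>B i (t $ i) \<omega>\<bar>) * f (btbs W B x t \<omega>))"


section \<open>Partial derivatives, Laplacian, Hoelder continuity\<close>

definition partial_exists :: "'d \<Rightarrow> (real ^ 'd \<Rightarrow> real) \<Rightarrow> real ^ 'd \<Rightarrow> bool" where
  "partial_exists k g x \<longleftrightarrow> (\<lambda>h::real. g (x + h *\<^sub>R axis k 1)) field_differentiable (at 0)"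

definition partial :: "'d \<Rightarrow> (real ^ 'd \<Rightarrow> real) \<Rightarrow> real ^ 'd \<Rightarrow> real" where
  "partial k g x = deriv (\<lambda>h::real. g (x + h *\<^sub>R axis k 1)) 0"

definition second_partials_exist :: "(real ^ 'd \<Rightarrow> real) \<Rightarrow> bool" where
  "second_partials_exist g \<longleftrightarrow>
     (\<forall>l x. partial_exists l g x) \<and> (\<forall>k l x. partial_exists k (partial l g) x)"

definition laplacian :: "(real ^ 'd \<Rightarrow> real) \<Rightarrow> real ^ 'd \<Rightarrow> real" where
  "laplacian g x = (\<Sum>k\<in>UNIV. partial k (partial k g) x)"

definition hoelder :: "real \<Rightarrow> (real ^ 'd \<Rightarrow> real) \<Rightarrow> bool" where
  "hoelder \<alpha> g \<longleftrightarrow> (\<exists>C. \<forall>x y. \<bar>g x - g y\<bar> \<le> C * norm (x - y) powr \<alpha>)"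


section \<open>Caputo derivative\<close>

definition caputo_deriv :: "real \<Rightarrow> (real \<Rightarrow> real) \<Rightarrow> real \<Rightarrow> real" where
  "caputo_deriv \<beta> v t =
     1 / Gamma (1 - \<beta>) * (LINT s:{0<..<t}|lborel. deriv v s / (t - s) powr \<beta>)"

text \<open>When the Caputo integral at \<open>t\<close> is meaningful: \<open>v\<close> is continuous on \<open>[0,\<infinity>)\<close>, \<open>C\<^sup>1\<close> on
  \<open>(0,\<infinity>)\<close>, and the integral converges absolutely. One cannot ask for \<open>C\<^sup>1\<close> up to time \<open>0\<close>:
  the time derivatives of \<^const>\<open>btbs_u\<close> are in general of order \<open>s\<^sup>-\<^sup>1\<^sup>/\<^sup>2\<close> there.\<close>

definition caputo_exists :: "real \<Rightarrow> (real \<Rightarrow> real) \<Rightarrow> real \<Rightarrow> bool" where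
  "caputo_exists \<beta> v t \<longleftrightarrow>
     continuous_on {0..} v \<and>
     (\<forall>s>0. v field_differentiable (at s)) \<and>
     continuous_on {0<..} (deriv v) \<and>
     set_integrable lborel {0<..<t} (\<lambda>s. deriv v s / (t - s) powr \<beta>)"

end

theory Submission
  imports Defs "HOL-Real_Asymp.Real_Asymp"
begin

text \<open>
  Conditionally on the Brownian times, \<open>W\<^sup>x\<close> evaluated at them is Gaussian with variance
  \<open>p = \<Prod>\<^sub>i |B\<^sub>i(t\<^sub>i)|\<close>. Hence \<open>u = E[\<phi>(p)]\<close> and \<open>\<Delta>V\<^sub>j = E[Q \<psi>(p)]\<close>, where \<open>\<phi>(p) = E f(x + \<surd>p \<zeta>)\<close> and
  \<open>\<psi>(p) = E \<Delta>f(x + \<surd>p \<zeta>)\<close> for a standard Gaussian vector \<open>\<zeta>\<close>, and \<open>Q\<close> is the product of the times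
  other than the \<open>j\<close>-th. By the heat equation \<open>\<phi>' = \<psi> / 2\<close>, the time derivative of \<open>u\<close> in \<open>t\<^sub>j = s\<close> is
  an integral of \<open>\<psi>(|y| Q) Q / 4\<close> against \<open>|y| / s\<close> times the centred normal density of variance \<open>s\<close>
  in \<open>y\<close>, that is, up to a constant, against the density in \<open>s\<close> of the first passage time of
  Brownian motion to \<open>|y|\<close>. Convolving that density with \<open>(t - s)\<^sup>-\<^sup>1\<^sup>/\<^sup>2\<close> gives back a multiple of the normal
  density of variance \<open>t\<close>; by Fubini, the half derivative of \<open>u\<close> is therefore a multiple of
  \<open>E[Q \<psi>(p)]\<close>, and the constants combine to \<open>1 / \<surd>8\<close>.
\<close>

section \<open>Partial derivatives and dominated convergence\<close>

text \<open>The factor \<open>|y| / s\<close> comes from Brownian scaling.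
  \<open>B\<^sub>j(s)\<close> has the law of \<open>\<surd>s z\<close> with a fixed standard
  Gaussian \<open>z\<close>, so time enters through the argument of \<open>\<phi>\<close>, and
  differentiation gives \<open>\<psi>(\<surd>s |z| Q) |z| Q / (4 \<surd>s)\<close>; with
  \<open>y = \<surd>s z\<close>, \<open>|z| / \<surd>s\<close> becomes \<open>|y| / s\<close>. No
  normal density is ever differentiated in time, so a bounded \<open>\<psi>\<close> and a finite
  first moment of \<open>Q\<close> suffice for domination. The convolution consumes the factor
  \<open>|y|\<close>, which is why the surviving weight is \<open>Q\<close>, that of
  \<open>V\<^sub>j\<close>, and not the full product \<open>p\<close>. The constant is 1/2 (heat
  equation) times 1/2 (derivative of the square root) times \<open>\<surd>(2\<pi>)\<close> (kernel)
  times \<open>1 / \<surd>\<pi>\<close> (from \<open>Gamma (1/2)\<close>). The hypotheses bound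
  \<open>f\<close> and its second partials, but say nothing of the size of the first partials or of
  continuity of \<open>f\<close>; both have to be recovered before anything is differentiated under
  an expectation.\<close>

lemma partial_has_real_derivative:
  assumes "partial_exists k g (x + s *\<^sub>R axis k 1)"
  shows "((\<lambda>r. g (x + r *\<^sub>R axis k 1)) has_real_derivative partial k g (x + s *\<^sub>R axis k 1)) (at s)"
proof -
  \<comment> \<open>The point 0 is written \<open>s + - s\<close> so that \<open>DERIV_shift\<close>
    moves the derivative to \<open>s\<close>.\<close>
  have "((\<lambda>h. g (x + s *\<^sub>R axis k 1 + h *\<^sub>R axis k 1)) has_real_derivative
      partial k g (x + s *\<^sub>R axis k 1)) (at (s + - s))"
    using assms unfolding partial_exists_def partial_def
    by (simp add: DERIV_deriv_iff_field_differentiable)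
  then show ?thesis
    unfolding DERIV_shift by (simp add: add.assoc flip: scaleR_add_left)
qed

lemma partialI:
  assumes "((\<lambda>h. g (x + h *\<^sub>R axis k 1)) has_real_derivative D) (at 0)"
  shows "partial_exists k g x" "partial k g x = D"
  using assms unfolding partial_exists_def partial_def
  by (auto simp: field_differentiable_def DERIV_imp_deriv)

lemma partial_mvt:
  fixes g :: "real ^ 'd \<Rightarrow> real"
  assumes "\<And>y. partial_exists k g y"
  obtains \<theta> where "\<bar>\<theta>\<bar> \<le> \<bar>h\<bar>" "g (x + h *\<^sub>R axis k 1) - g x = h * partial k g (x + \<theta> *\<^sub>R axis k 1)"
proof -
  have D: "((\<lambda>r. g (x + r *\<^sub>R axis k 1)) has_real_derivative partial k g (x + s *\<^sub>R axis k 1)) (at s)" for s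
    by (rule partial_has_real_derivative) (rule assms)
  consider "h = 0" | "h > 0" | "h < 0" by linarith
  then show ?thesis
  proof cases
    case 1 then show ?thesis using that[of 0] by simp
  next
    case 2
    from MVT2[OF 2, of "\<lambda>r. g (x + r *\<^sub>R axis k 1)", OF D]
    obtain z where "0 < z" "z < h" "g (x + h *\<^sub>R axis k 1) - g (x + 0 *\<^sub>R axis k 1) =
        (h - 0) * partial k g (x + z *\<^sub>R axis k 1)" by blast
    then show ?thesis using that[of z] by simp
  next
    case 3
    from MVT2[OF 3, of "\<lambda>r. g (x + r *\<^sub>R axis k 1)", OF D]
    obtain z where "h < z" "z < 0" "g (x + 0 *\<^sub>R axis k 1) - g (x + h *\<^sub>R axis k 1) =
        (0 - h) * partial k g (x + z *\<^sub>R axis k 1)" by blast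
    then show ?thesis using that[of z] by (simp add: algebra_simps)
  qed
qed

lemma norm_sum_axis_le:
  fixes v :: "real ^ 'd"
  shows "norm (\<Sum>k\<in>S. v $ k *\<^sub>R axis k (1::real)) \<le> (\<Sum>k\<in>S. \<bar>v $ k\<bar>)"
  by (rule order_trans[OF norm_sum]) (simp add: norm_axis_1)

lemma sum_axis: "(\<Sum>k\<in>UNIV. v $ k *\<^sub>R axis k (1::real)) = (v :: real ^ 'd)"
  by (simp add: basis_expansion flip: scalar_mult_eq_scaleR)

text \<open>The path from \<open>x\<close> to \<open>x + v\<close> changes one coordinate at a time,
  with the mean value theorem on each segment. Every point met is within the l1-norm of
  \<open>v\<close> from \<open>x\<close>, so \<open>c\<close> has to approximate the partials only
  there. Taking \<open>c = 0\<close> yields a Lipschitz bound, taking the gradient at a point yields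
  differentiability.\<close>

lemma partials_increment_bound:
  fixes g :: "real ^ 'd \<Rightarrow> real"
  assumes ex: "\<And>k y. partial_exists k g y"
    and c: "\<And>k y. norm (y - x) \<le> (\<Sum>k\<in>UNIV. \<bar>v $ k\<bar>) \<Longrightarrow> \<bar>partial k g y - c k\<bar> \<le> e"
  shows "\<bar>g (x + v) - g x - (\<Sum>k\<in>UNIV. v $ k * c k)\<bar> \<le> e * (\<Sum>k\<in>UNIV. \<bar>v $ k\<bar>)"
proof -
  have "\<bar>g (x + (\<Sum>k\<in>S. v $ k *\<^sub>R axis k 1)) - g x - (\<Sum>k\<in>S. v $ k * c k)\<bar> \<le> e * (\<Sum>k\<in>S. \<bar>v $ k\<bar>)"
    for S
  proof (induction S rule: infinite_finite_induct)
    case (insert k S)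
    let ?y = "x + (\<Sum>k\<in>S. v $ k *\<^sub>R axis k 1)"
    obtain \<theta> where \<theta>: "\<bar>\<theta>\<bar> \<le> \<bar>v $ k\<bar>"
      "g (?y + (v $ k) *\<^sub>R axis k 1) - g ?y = v $ k * partial k g (?y + \<theta> *\<^sub>R axis k 1)"
      using partial_mvt[of k g "v $ k" ?y, OF ex] by blast
    have "norm (?y + \<theta> *\<^sub>R axis k 1 - x) \<le> (\<Sum>k\<in>S. \<bar>v $ k\<bar>) + \<bar>\<theta>\<bar>"
    proof -
      have "?y + \<theta> *\<^sub>R axis k 1 - x = (\<Sum>k\<in>S. v $ k *\<^sub>R axis k 1) + \<theta> *\<^sub>R axis k 1" by simp
      then show ?thesis
        using norm_triangle_ineq[of "\<Sum>k\<in>S. v $ k *\<^sub>R axis k (1::real)" "\<theta> *\<^sub>R axis k 1"]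
          norm_sum_axis_le[of v S] by (simp add: norm_axis_1)
    qed
    also have "\<dots> \<le> (\<Sum>k\<in>insert k S. \<bar>v $ k\<bar>)" using insert \<theta> by simp
    also have "\<dots> \<le> (\<Sum>k\<in>UNIV. \<bar>v $ k\<bar>)" by (rule sum_mono2) auto
    finally have "\<bar>partial k g (?y + \<theta> *\<^sub>R axis k 1) - c k\<bar> \<le> e" by (rule c)
    then have "\<bar>v $ k\<bar> * \<bar>partial k g (?y + \<theta> *\<^sub>R axis k 1) - c k\<bar> \<le> \<bar>v $ k\<bar> * e"
      by (rule mult_left_mono) simp
    then have "\<bar>v $ k * partial k g (?y + \<theta> *\<^sub>R axis k 1) - v $ k * c k\<bar> \<le> e * \<bar>v $ k\<bar>"
      unfolding abs_mult[symmetric] right_diff_distrib by (simp only: mult.commute)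
    with insert show ?case using \<theta>(2)
      by (simp add: algebra_simps)
  qed auto
  from this[of UNIV] show ?thesis by (simp add: sum_axis)
qed

text \<open>Existence of partials alone does not give continuity; bounded partials give a Lipschitz
  bound. This is the source of continuity of \<open>f\<close> and of its first partials.\<close>

lemma continuous_on_bounded_partials:
  fixes g :: "real ^ 'd \<Rightarrow> real"
  assumes ex: "\<And>k y. partial_exists k g y"
    and bd: "\<And>k y. \<bar>partial k g y\<bar> \<le> C"
  shows "continuous_on UNIV g"
proof -
  have "C \<ge> 0" using bd[of undefined undefined] by linarith
  have "(g \<longlongrightarrow> g x) (at x)" for x
  proof -
    have "\<bar>g y - g x\<bar> \<le> C * (\<Sum>k\<in>UNIV. \<bar>(y - x) $ k\<bar>)" for y
      using partials_increment_bound[of g x "y - x" "\<lambda>_. 0" C] ex bd by simp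
    moreover have "((\<lambda>y. C * (\<Sum>k\<in>UNIV. \<bar>(y - x) $ k\<bar>)) \<longlongrightarrow> C * (\<Sum>k\<in>UNIV. \<bar>(x - x) $ k\<bar>)) (at x)"
      by (intro tendsto_intros)
    ultimately have "((\<lambda>y. g y - g x) \<longlongrightarrow> 0) (at x)"
      by (intro Lim_null_comparison[of "\<lambda>y. g y - g x" "\<lambda>y. C * (\<Sum>k\<in>UNIV. \<bar>(y - x) $ k\<bar>)"])
        simp_all
    then show ?thesis by (rule LIM_zero_cancel)
  qed
  then show ?thesis by (simp add: continuous_on_def)
qed

text \<open>Continuity of the partials upgrades them to a total derivative, here along a line. It
  serves to differentiate \<open>g (x + sqrt p *\<^sub>R \<zeta>)\<close> in
  \<open>p\<close>.\<close>

lemma ray_has_real_derivative: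
  fixes g :: "real ^ 'd \<Rightarrow> real"
  assumes ex: "\<And>k y. partial_exists k g y"
    and cont: "\<And>k. continuous_on UNIV (partial k g)"
  shows "((\<lambda>r. g (x + r *\<^sub>R v)) has_real_derivative (\<Sum>k\<in>UNIV. v $ k * partial k g (x + s *\<^sub>R v))) (at s)"
    (is "(?G has_real_derivative ?D) _")
proof -
  let ?y = "x + s *\<^sub>R v" and ?n = "\<Sum>k\<in>UNIV. \<bar>v $ k\<bar>"
  have n0: "?n \<ge> 0" by (simp add: sum_nonneg)
  have "((\<lambda>r. (?G r - ?G s) / (r - s) - ?D) \<longlongrightarrow> 0) (at s)"
  proof (rule tendstoI)
    fix e :: real assume e: "e > 0"
    \<comment> \<open>The \<open>+ 1\<close> covers \<open>v = 0\<close> and makes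
      \<open>e' * ?n\<close> strictly smaller than \<open>e\<close>.\<close>
    define e' where "e' = e / (?n + 1)"
    have e': "e' > 0" unfolding e'_def by (rule divide_pos_pos) (use e n0 in linarith)+
    have "e' * ?n < e' * (?n + 1)" using e' by (rule mult_strict_left_mono[rotated]) simp
    then have e'n: "e' * ?n < e" using n0 by (simp add: e'_def)
    have "\<forall>\<^sub>F z in at ?y. \<forall>k. \<bar>partial k g z - partial k g ?y\<bar> < e'"
    proof (rule eventually_all_finite)
      show "\<forall>\<^sub>F z in at ?y. \<bar>partial k g z - partial k g ?y\<bar> < e'" for k
        using cont[of k] e' by (auto simp: continuous_on_def tendsto_iff dist_real_def)
    qed
    then obtain d where d: "d > 0"
      "\<And>z k. z \<noteq> ?y \<Longrightarrow> dist z ?y < d \<Longrightarrow> \<bar>partial k g z - partial k g ?y\<bar> < e'"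
      unfolding eventually_at by (elim exE conjE) blast
    have d': "\<bar>partial k g z - partial k g ?y\<bar> \<le> e'" if "norm (z - ?y) < d" for z k
    proof (cases "z = ?y")
      case True then show ?thesis using e' by simp
    next
      case False then show ?thesis using d(2)[of z k] that unfolding dist_norm by (metis less_imp_le)
    qed
    have "\<forall>\<^sub>F r in at s. r \<noteq> s \<and> \<bar>r - s\<bar> * ?n < d"
    proof -
      have "((\<lambda>r. \<bar>r - s\<bar> * ?n) \<longlongrightarrow> \<bar>s - s\<bar> * ?n) (at s)" by (intro tendsto_intros)
      then have "\<forall>\<^sub>F r in at s. \<bar>r - s\<bar> * ?n < d" using d(1) by (auto dest: order_tendstoD)
      then show ?thesis by (intro eventually_conj) (auto simp: eventually_at_filter)
    qed
    then show "\<forall>\<^sub>F r in at s. dist ((?G r - ?G s) / (r - s) - ?D) 0 < e"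
    proof eventually_elim
      case (elim r)
      have nr: "(\<Sum>k\<in>UNIV. \<bar>((r - s) *\<^sub>R v) $ k\<bar>) = \<bar>r - s\<bar> * ?n"
        by (simp add: abs_mult sum_distrib_left)
      have "\<bar>g (?y + (r - s) *\<^sub>R v) - g ?y - (\<Sum>k\<in>UNIV. ((r - s) *\<^sub>R v) $ k * partial k g ?y)\<bar>
          \<le> e' * (\<Sum>k\<in>UNIV. \<bar>((r - s) *\<^sub>R v) $ k\<bar>)"
        by (rule partials_increment_bound[OF ex]) (use elim d' nr in auto)
      also have "?y + (r - s) *\<^sub>R v = x + r *\<^sub>R v" by (simp add: algebra_simps)
      also have "(\<Sum>k\<in>UNIV. ((r - s) *\<^sub>R v) $ k * partial k g ?y) = (r - s) * ?D"
        by (simp add: sum_distrib_left mult.assoc)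
      finally have "\<bar>?G r - ?G s - (r - s) * ?D\<bar> \<le> (e' * ?n) * \<bar>r - s\<bar>"
        by (simp only: nr mult_ac)
      moreover have "(?G r - ?G s) / (r - s) - ?D = (?G r - ?G s - (r - s) * ?D) / (r - s)"
        using elim by (simp add: field_simps)
      ultimately have "\<bar>(?G r - ?G s) / (r - s) - ?D\<bar> \<le> e' * ?n"
        using elim by (simp add: abs_divide pos_divide_le_eq)
      then show ?case using e'n by simp
    qed
  qed
  then show ?thesis
    unfolding has_field_derivative_iff by (rule LIM_zero_cancel)
qed

text \<open>Interpolation of Landau type: the increment of \<open>g\<close> over a unit step, at
  most \<open>2 * A\<close>, equals the first partial at a point at distance at most 1, and that
  value differs from the one at \<open>x\<close> by at most \<open>C\<close>.\<close>

lemma bounded_partial: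
  fixes g :: "real ^ 'd \<Rightarrow> real"
  assumes ex: "\<And>y. partial_exists k g y" "\<And>y. partial_exists k (partial k g) y"
    and A: "\<And>y. \<bar>g y\<bar> \<le> A" and C: "\<And>y. \<bar>partial k (partial k g) y\<bar> \<le> C"
  shows "\<bar>partial k g x\<bar> \<le> 2 * A + C"
proof -
  obtain \<theta> where \<theta>: "\<bar>\<theta>\<bar> \<le> \<bar>1\<bar>"
    "g (x + 1 *\<^sub>R axis k 1) - g x = 1 * partial k g (x + \<theta> *\<^sub>R axis k 1)"
    using partial_mvt[of k g 1 x, OF ex(1)] by blast
  obtain \<eta> where "\<bar>\<eta>\<bar> \<le> \<bar>\<theta>\<bar>" and
    \<eta>: "partial k g (x + \<theta> *\<^sub>R axis k 1) - partial k g x = \<theta> * partial k (partial k g) (x + \<eta> *\<^sub>R axis k 1)"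
    using partial_mvt[of k "partial k g" \<theta> x, OF ex(2)] by blast
  have "\<bar>\<theta> * partial k (partial k g) (x + \<eta> *\<^sub>R axis k 1)\<bar> \<le> 1 * C"
    unfolding abs_mult by (rule mult_mono) (use \<theta> C in auto)
  then show ?thesis
    using \<theta>(2) \<eta> A[of x] A[of "x + 1 *\<^sub>R axis k 1"] by (simp add: abs_le_iff)
qed

lemma hoelder_continuous_on:
  fixes g :: "real ^ 'd \<Rightarrow> real"
  assumes "hoelder \<alpha> g" "\<alpha> > 0"
  shows "continuous_on UNIV g"
proof -
  from assms obtain C where C: "\<And>x y. \<bar>g x - g y\<bar> \<le> C * norm (x - y) powr \<alpha>"
    by (auto simp: hoelder_def)
  have "(g \<longlongrightarrow> g x) (at x)" for x
  proof -
    have "((\<lambda>y. C * norm (y - x) powr \<alpha>) \<longlongrightarrow> C * norm (x - x) powr \<alpha>) (at x)"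
      using \<open>\<alpha> > 0\<close> by (intro tendsto_intros) auto
    then have "((\<lambda>y. g y - g x) \<longlongrightarrow> 0) (at x)"
      using C by (intro Lim_null_comparison[of "\<lambda>y. g y - g x" "\<lambda>y. C * norm (y - x) powr \<alpha>"]) simp_all
    then show ?thesis by (rule LIM_zero_cancel)
  qed
  then show ?thesis by (simp add: continuous_on_def)
qed

section \<open>Limits and derivatives under the integral sign\<close>

lemma tendsto_integral_dominated:
  fixes h :: "'b::first_countable_topology \<Rightarrow> 'a \<Rightarrow> real"
  assumes meas: "\<And>s. s \<in> S \<Longrightarrow> h s \<in> borel_measurable M" "l \<in> borel_measurable M"
    and lim: "\<And>\<omega>. \<omega> \<in> space M \<Longrightarrow> ((\<lambda>s. h s \<omega>) \<longlongrightarrow> l \<omega>) (at a within S)"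
    and bd: "\<And>s \<omega>. s \<in> S \<Longrightarrow> \<omega> \<in> space M \<Longrightarrow> \<bar>h s \<omega>\<bar> \<le> w \<omega>"
    and w: "integrable M w"
  shows "((\<lambda>s. integral\<^sup>L M (h s)) \<longlongrightarrow> integral\<^sup>L M l) (at a within S)"
  unfolding tendsto_at_iff_sequentially comp_def
proof (intro allI impI)
  fix X assume X: "\<forall>i. X i \<in> S - {a}" "X \<longlonglongrightarrow> a"
  show "(\<lambda>i. integral\<^sup>L M (h (X i))) \<longlonglongrightarrow> integral\<^sup>L M l"
  proof (rule integral_dominated_convergence[OF meas(2) _ w])
    show "AE \<omega> in M. (\<lambda>i. h (X i) \<omega>) \<longlonglongrightarrow> l \<omega>"
      using lim X by (intro AE_I2) (auto simp: tendsto_at_iff_sequentially comp_def)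
  qed (use X meas bd in auto)
qed

text \<open>By the mean value theorem the difference quotients are values of \<open>g'\<close> at
  intermediate points, so \<open>w\<close> dominates them too and dominated convergence
  applies.\<close>

lemma has_real_derivative_integral:
  fixes g g' :: "real \<Rightarrow> 'a \<Rightarrow> real"
  assumes "d > 0"
    and int: "\<And>s. dist s s0 < d \<Longrightarrow> integrable M (g s)"
    and der: "\<And>s \<omega>. dist s s0 < d \<Longrightarrow> \<omega> \<in> space M \<Longrightarrow> ((\<lambda>s. g s \<omega>) has_real_derivative g' s \<omega>) (at s)"
    and bd: "\<And>s \<omega>. dist s s0 < d \<Longrightarrow> \<omega> \<in> space M \<Longrightarrow> \<bar>g' s \<omega>\<bar> \<le> w \<omega>"
    and meas: "g' s0 \<in> borel_measurable M"
    and w: "integrable M w"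
  shows "((\<lambda>s. integral\<^sup>L M (g s)) has_real_derivative integral\<^sup>L M (g' s0)) (at s0)"
proof -
  let ?q = "\<lambda>s \<omega>. (g s \<omega> - g s0 \<omega>) / (s - s0)" and ?S = "ball s0 d - {s0}"
  have S: "at s0 within ?S = at s0"
    using \<open>d > 0\<close> by (intro at_within_nhd[of s0 "ball s0 d"]) auto
  have "((\<lambda>s. integral\<^sup>L M (?q s)) \<longlongrightarrow> integral\<^sup>L M (g' s0)) (at s0 within ?S)"
  proof (rule tendsto_integral_dominated[OF _ meas _ _ w])
    fix s assume "s \<in> ?S"
    then have s: "dist s s0 < d" "s \<noteq> s0" by (auto simp: dist_commute)
    have [measurable]: "g s \<in> borel_measurable M" "g s0 \<in> borel_measurable M"
      using int[OF s(1)] int[of s0] \<open>d > 0\<close> by auto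
    show "?q s \<in> borel_measurable M" by measurable
    fix \<omega> assume \<omega>: "\<omega> \<in> space M"
    have near: "dist r s0 < d" if "min s s0 \<le> r" "r \<le> max s s0" for r
      using that s(1) by (auto simp: dist_real_def min_def max_def split: if_splits)
    have "\<exists>z. dist z s0 < d \<and> g s \<omega> - g s0 \<omega> = (s - s0) * g' z \<omega>"
    proof (cases "s < s0")
      case True
      have "\<exists>z>s. z < s0 \<and> g s0 \<omega> - g s \<omega> = (s0 - s) * g' z \<omega>"
        using True near by (intro MVT2 der \<omega>) auto
      then obtain z where "s < z" "z < s0" "g s0 \<omega> - g s \<omega> = (s0 - s) * g' z \<omega>" by blast
      then show ?thesis using near[of z] True by (intro exI[of _ z]) (auto simp: algebra_simps)
    next
      case False
      then have "\<exists>z>s0. z < s \<and> g s \<omega> - g s0 \<omega> = (s - s0) * g' z \<omega>"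
        using s near by (intro MVT2 der \<omega>) auto
      then obtain z where "s0 < z" "z < s" "g s \<omega> - g s0 \<omega> = (s - s0) * g' z \<omega>" by blast
      then show ?thesis using near[of z] by (intro exI[of _ z]) auto
    qed
    then obtain z where "dist z s0 < d" "g s \<omega> - g s0 \<omega> = (s - s0) * g' z \<omega>" by blast
    then show "\<bar>?q s \<omega>\<bar> \<le> w \<omega>" using bd[OF _ \<omega>] s by simp
  next
    fix \<omega> assume "\<omega> \<in> space M"
    then show "((\<lambda>s. ?q s \<omega>) \<longlongrightarrow> g' s0 \<omega>) (at s0 within ?S)"
      using der[of s0 \<omega>] \<open>d > 0\<close> unfolding S by (simp add: has_field_derivative_iff)
  qed
  then have "((\<lambda>s. integral\<^sup>L M (?q s)) \<longlongrightarrow> integral\<^sup>L M (g' s0)) (at s0)" unfolding S .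
  moreover have "\<forall>\<^sub>F s in at s0. integral\<^sup>L M (?q s) = (integral\<^sup>L M (g s) - integral\<^sup>L M (g s0)) / (s - s0)"
    using \<open>d > 0\<close> int[of s0] by (auto simp: eventually_at intro!: exI[of _ d] simp: int)
  ultimately show ?thesis
    unfolding has_field_derivative_iff by (rule Lim_transform_eventually)
qed

section \<open>Gaussian integrals\<close>

abbreviation std_gaussian :: "real measure" where
  "std_gaussian \<equiv> density lborel (\<lambda>x. ennreal (std_normal_density x))"

lemma prob_space_std_gaussian: "prob_space std_gaussian"
  using prob_space_normal_density[of 1 0] by simp

text \<open>Scaling one fixed measure treats \<open>\<sigma> = 0\<close> together with the other
  cases and moves the dependence on the variance from the measure into the integrand.\<close>

lemma centred_gaussian_eq_distr:
  assumes "\<sigma> \<ge> 0"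
  shows "centred_gaussian \<sigma> = distr std_gaussian borel (\<lambda>z. \<sigma> * z)"
proof (cases "\<sigma> = 0")
  case True
  then show ?thesis
    using prob_space.distr_const[OF prob_space_std_gaussian, of "0::real" borel] by (simp add: centred_gaussian_def)
next
  case False
  interpret prob_space std_gaussian by (rule prob_space_std_gaussian)
  have "distributed std_gaussian lborel (\<lambda>x. x) std_normal_density"
    by (simp add: distributed_def) (metis distr_id2 sets_density)
  from normal_density_affine[OF this, of \<sigma> 0] False assms
  have "distributed std_gaussian lborel (\<lambda>x. \<sigma> * x) (normal_density 0 \<sigma>)" by simp
  then have "distr std_gaussian lborel (\<lambda>x. \<sigma> * x) = density lborel (normal_density 0 \<sigma>)"
    by (rule distributed_distr_eq_density)
  moreover have "distr std_gaussian borel (\<lambda>x. \<sigma> * x) = distr std_gaussian lborel (\<lambda>x. \<sigma> * x)"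
    by (rule distr_cong) simp_all
  ultimately show ?thesis using False by (simp add: centred_gaussian_def)
qed

lemma integral_std_gaussian:
  fixes f :: "real \<Rightarrow> real"
  assumes [measurable]: "f \<in> borel_measurable borel"
  shows "(\<integral>z. f z \<partial>std_gaussian) = (\<integral>z. std_normal_density z * f z \<partial>lborel)"
  by (subst integral_density) auto

lemma integrable_std_gaussian_iff:
  fixes f :: "real \<Rightarrow> real"
  assumes [measurable]: "f \<in> borel_measurable borel"
  shows "integrable std_gaussian f \<longleftrightarrow> integrable lborel (\<lambda>z. std_normal_density z * f z)"
  by (subst integrable_density) auto

lemma integrable_std_gaussian_abs: "integrable std_gaussian (\<lambda>z. \<bar>z\<bar>)"
  using integrable_std_normal_moment_abs[of 1] by (simp add: integrable_std_gaussian_iff)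

lemma integral_std_gaussian_abs: "(\<integral>z. \<bar>z\<bar> \<partial>std_gaussian) = sqrt (2 / pi)"
  using integral_std_normal_moment_abs_odd[of 0] by (simp add: integral_std_gaussian)

lemma integral_centred_gaussian:
  fixes f :: "real \<Rightarrow> real"
  assumes "\<sigma> \<ge> 0" and [measurable]: "f \<in> borel_measurable borel"
  shows "(\<integral>y. f y \<partial>centred_gaussian \<sigma>) = (\<integral>z. f (\<sigma> * z) \<partial>std_gaussian)"
  unfolding centred_gaussian_eq_distr[OF assms(1)] by (rule integral_distr) auto

lemma integral_centred_gaussian_square:
  assumes "\<sigma> \<ge> 0"
  shows "(\<integral>y. y\<^sup>2 \<partial>centred_gaussian \<sigma>) = \<sigma>\<^sup>2"
proof -
  have "(\<integral>z. z\<^sup>2 \<partial>std_gaussian) = 1"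
    using integral_std_normal_moment_even[of 1] by (simp add: integral_std_gaussian)
  then show ?thesis by (simp add: integral_centred_gaussian assms power_mult_distrib)
qed

lemma tendsto_std_normal_density:
  "(std_normal_density \<longlongrightarrow> 0) at_top" "(std_normal_density \<longlongrightarrow> 0) at_bot"
  unfolding std_normal_density_def by real_asymp+

text \<open>Integration by parts: the density \<open>n\<close> satisfies
  \<open>n' z = - z * n z\<close>, so \<open>n z * g' z - n z * (z * g z)\<close> is the derivative
  of \<open>g z * n z\<close>, which tends to 0 at both ends because \<open>g\<close> is
  bounded.\<close>

lemma stein:
  fixes g g' :: "real \<Rightarrow> real"
  assumes der: "\<And>z. (g has_real_derivative g' z) (at z)"
    and cont: "continuous_on UNIV g'"
    and A: "\<And>z. \<bar>g z\<bar> \<le> A" and C: "\<And>z. \<bar>g' z\<bar> \<le> C"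
  shows "(\<integral>z. z * g z \<partial>std_gaussian) = (\<integral>z. g' z \<partial>std_gaussian)"
proof -
  let ?n = std_normal_density
  have contg: "continuous_on UNIV g"
    using der by (auto intro: DERIV_continuous_on)
  have [measurable]: "g \<in> borel_measurable borel" "g' \<in> borel_measurable borel"
    using contg cont by (auto intro: borel_measurable_continuous_onI)
  have dn: "(?n has_real_derivative - z * ?n z) (at z)" for z
  proof -
    have "((\<lambda>z::real. exp (- z\<^sup>2 / 2)) has_real_derivative exp (- z\<^sup>2 / 2) * (- z)) (at z)"
      by (auto intro!: derivative_eq_intros)
    from DERIV_cmult[OF this, of "1 / sqrt (2 * pi)"] show ?thesis
      unfolding std_normal_density_def by (simp add: mult_ac)
  qed
  have i1: "integrable lborel (\<lambda>z. ?n z * g' z)"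
    by (rule Bochner_Integration.integrable_bound[of _ "\<lambda>z. ?n z * C"])
      (auto intro!: AE_I2 mult_left_mono order_trans[OF C] simp: abs_mult)
  have i2: "integrable lborel (\<lambda>z. ?n z * (z * g z))"
  proof (rule Bochner_Integration.integrable_bound)
    show "integrable lborel (\<lambda>z. ?n z * \<bar>z\<bar> * A)"
      using integrable_std_normal_moment_abs[of 1] by simp
  qed (auto intro!: AE_I2 mult_left_mono order_trans[OF A] simp: abs_mult mult.assoc)
  have lim: "((\<lambda>z. g z * ?n z) \<longlongrightarrow> 0) F" if "(?n \<longlongrightarrow> 0) F" for F
  proof (rule Lim_null_comparison)
    show "((\<lambda>z. A * ?n z) \<longlongrightarrow> 0) F" using tendsto_mult_left[OF that, of A] by simp
    show "\<forall>\<^sub>F z in F. norm (g z * ?n z) \<le> A * ?n z"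
      by (auto simp: abs_mult intro!: always_eventually mult_right_mono A)
  qed
  have "(LBINT z=-\<infinity>..\<infinity>. ?n z * g' z - ?n z * (z * g z)) = 0 - 0"
  proof (rule interval_integral_FTC_integrable[where F="\<lambda>z. g z * ?n z"])
    show "((\<lambda>z. g z * ?n z) has_vector_derivative ?n x * g' x - ?n x * (x * g x)) (at x)" for x
      unfolding has_real_derivative_iff_has_vector_derivative[symmetric]
      by (auto intro!: derivative_eq_intros der dn simp: algebra_simps)
    have "continuous_on UNIV (\<lambda>z. ?n z * g' z - ?n z * (z * g z))"
      using cont contg unfolding std_normal_density_def by (intro continuous_intros) auto
    then show "isCont (\<lambda>z. ?n z * g' z - ?n z * (z * g z)) x" for x
      by (simp add: continuous_on_eq_continuous_at)
    show "set_integrable lborel (einterval (-\<infinity>) \<infinity>) (\<lambda>z. ?n z * g' z - ?n z * (z * g z))"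
      using i1 i2 by (simp add: set_integrable_def)
  qed (use lim tendsto_std_normal_density in \<open>simp_all add: ereal_tendsto_simps\<close>)
  then have "(\<integral>z. ?n z * g' z - ?n z * (z * g z) \<partial>lborel) = 0"
    by (simp add: interval_lebesgue_integral_def set_lebesgue_integral_def)
  then show ?thesis using i1 i2 by (simp add: integral_std_gaussian)
qed

text \<open>The substitution \<open>s = t / (1 + w\<^sup>2)\<close> gives
  \<open>t - s = s * w\<^sup>2\<close> and splits \<open>y\<^sup>2 / (2 * s)\<close> into
  \<open>y\<^sup>2 / (2 * t) + y\<^sup>2 * w\<^sup>2 / (2 * t)\<close>; what remains is a Gaussian
  integral over a half-line. Taking \<open>w < 0\<close> makes the substitution increasing.\<close>

lemma first_passage_kernel_integral:
  assumes "y > 0" "t > 0"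
  defines "K \<equiv> \<lambda>s. y / (s * sqrt s * sqrt (t - s)) * exp (- y\<^sup>2 / (2 * s))"
  shows "set_integrable lborel {0<..<t} K"
    and "(LINT s:{0<..<t}|lborel. K s) = sqrt (2 * pi / t) * exp (- y\<^sup>2 / (2 * t))"
proof -
  \<comment> \<open>\<open>(c * w)\<^sup>2\<close> is the part of the exponent that depends on
    \<open>w\<close>; the minus sign carries \<open>w < 0\<close> to the positive half-line of
    \<open>gaussian_moment_0\<close>.\<close>
  define c where "c = - y / sqrt (2 * t)"
  have c: "c < 0" using assms by (simp add: c_def)
  have c2: "(c * w)\<^sup>2 = y\<^sup>2 * w\<^sup>2 / (2 * t)" for w
    using assms by (simp add: c_def power_mult_distrib power_divide)
  have "has_bochner_integral lborel (\<lambda>w. indicator {0..} (0 + c * w) *\<^sub>R exp (- (0 + c * w)\<^sup>2))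
      ((sqrt pi / 2) /\<^sub>R \<bar>c\<bar>)"
    using lborel_has_bochner_integral_real_affine_iff[of c "\<lambda>w. indicator {0..} w *\<^sub>R exp (- w\<^sup>2)" "sqrt pi / 2" 0]
      gaussian_moment_0 c by simp
  then have hb: "has_bochner_integral lborel (\<lambda>w. indicator {..<0} w *\<^sub>R exp (- (c * w)\<^sup>2))
      (sqrt pi / (2 * \<bar>c\<bar>))"
  proof (subst has_bochner_integral_cong_AE[where g="\<lambda>w. indicator {0..} (0 + c * w) *\<^sub>R exp (- (0 + c * w)\<^sup>2)"])
    \<comment> \<open>The two indicators disagree only at \<open>w = 0\<close>.\<close>
    show "AE w in lborel. indicator {..<0} w *\<^sub>R exp (- (c * w)\<^sup>2) =
        indicat_real {0..} (0 + c * w) *\<^sub>R exp (- (0 + c * w)\<^sup>2)"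
      using AE_lborel_singleton[of 0]
      by eventually_elim (use c in \<open>auto simp: indicator_def zero_le_mult_iff\<close>)
  qed (auto simp: field_simps)
  let ?g = "\<lambda>w. t / (1 + w\<^sup>2)" and ?g' = "\<lambda>w. - 2 * w * t / (1 + w\<^sup>2)\<^sup>2"
  let ?G = "\<lambda>w. (2 * y / t * exp (- y\<^sup>2 / (2 * t))) * exp (- (c * w)\<^sup>2)"
  have pos: "1 + w\<^sup>2 > 0" for w :: real by (smt (verit) zero_le_power2)
  have gpos: "0 < ?g w" "?g w < t" if "w < 0" for w
    using assms pos[of w] that by (auto simp: field_simps)
  have KG: "K (?g w) * ?g' w = ?G w" if "w < 0" for w
  proof -
    \<comment> \<open>\<open>r\<close> is \<open>sqrt s\<close>; since \<open>w < 0\<close>, the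
      root of \<open>t - s = (r * w)\<^sup>2\<close> is \<open>- (r * w)\<close>.\<close>
    define r where "r = sqrt (t / (1 + w\<^sup>2))"
    have r: "r > 0" "r\<^sup>2 = t / (1 + w\<^sup>2)" using assms pos[of w] by (auto simp: r_def)
    have "t - ?g w = (r * w)\<^sup>2" using pos[of w] by (simp add: power_mult_distrib r(2) field_simps)
    then have s: "sqrt (t - ?g w) = - (r * w)" using r that by (simp add: abs_mult)
    have e: "exp (- y\<^sup>2 / (2 * ?g w)) = exp (- y\<^sup>2 / (2 * t)) * exp (- (c * w)\<^sup>2)"
      unfolding c2 exp_add[symmetric] using assms pos[of w] by (simp add: field_simps)
    have "K (?g w) * ?g' w = y / (r\<^sup>2 * r * (- (r * w))) * ?g' w * exp (- y\<^sup>2 / (2 * ?g w))"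
      unfolding K_def s r(2) r_def[symmetric] by simp
    also have "y / (r\<^sup>2 * r * (- (r * w))) * ?g' w = 2 * y * t / ((r\<^sup>2)\<^sup>2 * (1 + w\<^sup>2)\<^sup>2)"
    proof -
      have "y / (r\<^sup>2 * r * (- (r * w))) * (- 2 * w * t / D) = 2 * y * t / ((r\<^sup>2)\<^sup>2 * D)" for D
        using r(1) that by (cases "D = 0") (simp_all add: field_simps power2_eq_square)
      then show ?thesis .
    qed
    also have "\<dots> = 2 * y / t"
      using pos[of w] assms unfolding r(2) by (simp add: power_divide power2_eq_square)
    finally show ?thesis unfolding e by simp
  qed
  have int: "set_integrable lborel {..<0} ?G"
    unfolding set_integrable_def
    using integrable.intros[OF has_bochner_integral_mult_right[OF hb, of "2 * y / t * exp (- y\<^sup>2 / (2 * t))"]]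
    by (simp add: mult_ac)
  have prem: "DERIV ?g w :> ?g' w" "isCont K (?g w)" "isCont ?g' w" "0 \<le> K (?g w)"
    if "- \<infinity> < ereal w" "ereal w < 0" for w
  proof -
    have w: "w < 0" using that by simp
    show "DERIV ?g w :> ?g' w"
      using pos[of w] by (auto intro!: derivative_eq_intros simp: power2_eq_square)
    show "isCont K (?g w)"
      unfolding K_def using gpos[OF w] by (intro continuous_intros) auto
    show "isCont ?g' w" using pos[of w] by (intro continuous_intros) auto
    show "0 \<le> K (?g w)" unfolding K_def using gpos[OF w] assms by auto
  qed
  have g'0: "0 \<le> ?g' w" if "- \<infinity> \<le> ereal w" "ereal w \<le> 0" for w
    using assms(2) that by (simp add: divide_le_0_iff mult_le_0_iff)
  have "((\<lambda>w. ereal (?g w)) \<longlongrightarrow> ereal 0) at_bot"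
    by (intro tendsto_ereal) (use assms in real_asymp)
  then have lim0: "((ereal \<circ> ?g \<circ> real_of_ereal) \<longlongrightarrow> 0) (at_right (- \<infinity>))"
    unfolding ereal_tendsto_simps zero_ereal_def by (simp add: comp_def)
  have "((\<lambda>w. ereal (?g w)) \<longlongrightarrow> ereal (?g 0)) (at_left 0)"
    by (intro tendsto_intros) auto
  then have limt: "((ereal \<circ> ?g \<circ> real_of_ereal) \<longlongrightarrow> ereal t) (at_left 0)"
    unfolding zero_ereal_def ereal_tendsto_simps by (simp add: comp_def)
  have int': "set_integrable lborel (einterval (- \<infinity>) 0) (\<lambda>w. K (?g w) * ?g' w)"
    unfolding zero_ereal_def einterval_eq
    by (rule set_integrable_cong[THEN iffD1, OF refl refl _ int], rule KG[symmetric], simp)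
  have neg: "- \<infinity> < (0::ereal)" by simp
  \<comment> \<open>Nonnegativity of \<open>K\<close> lets integrability, and not only the value, be
    transported back from the \<open>w\<close> side.\<close>
  note sub = interval_integral_substitution_nonneg[OF neg prem g'0 lim0 limt int']
  show "set_integrable lborel {0<..<t} K"
    using sub(1) by (simp add: zero_ereal_def)
  have "(LINT s:{0<..<t}|lborel. K s) = (LBINT s=0..ereal t. K s)"
    using assms by (simp add: interval_lebesgue_integral_def zero_ereal_def)
  also have "\<dots> = (LBINT w=-\<infinity>..0. K (?g w) * ?g' w)"
    by (rule sub(2))
  also have "\<dots> = (LINT w:{..<0}|lborel. K (?g w) * ?g' w)"
    unfolding interval_lebesgue_integral_def zero_ereal_def einterval_eq by simp
  also have "\<dots> = (LINT w:{..<0}|lborel. ?G w)"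
    by (rule set_lebesgue_integral_cong) (simp, intro allI impI, rule KG, simp)
  also have "\<dots> = (2 * y / t * exp (- y\<^sup>2 / (2 * t))) * (sqrt pi / (2 * \<bar>c\<bar>))"
    using has_bochner_integral_integral_eq[OF hb]
    by (subst set_integral_mult_right) (simp add: set_lebesgue_integral_def)
  also have "\<dots> = sqrt (2 * pi / t) * exp (- y\<^sup>2 / (2 * t))"
    using assms by (simp add: c_def real_sqrt_mult real_sqrt_divide field_simps)
  finally show "(LINT s:{0<..<t}|lborel. K s) = sqrt (2 * pi / t) * exp (- y\<^sup>2 / (2 * t))" .
qed

section \<open>Standard Gaussian vectors and the heat semigroup\<close>

lemma borel_measurable_vec_nth: "(\<lambda>v :: real ^ 'n. v $ k) \<in> borel_measurable borel"
  by (intro borel_measurable_continuous_onI continuous_intros)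

lemma borel_measurable_vec_lambda:
  fixes X :: "'a \<Rightarrow> 'n::finite \<Rightarrow> real"
  assumes "\<And>k. (\<lambda>\<omega>. X \<omega> k) \<in> borel_measurable M"
  shows "(\<lambda>\<omega>. \<chi> k. X \<omega> k) \<in> borel_measurable M"
proof (subst borel_measurable_euclidean_space, intro ballI)
  fix b :: "real ^ 'n" assume "b \<in> Basis"
  then obtain k where "b = axis k 1" by (auto simp: Basis_vec_def)
  then show "(\<lambda>\<omega>. (\<chi> k. X \<omega> k) \<bullet> b) \<in> borel_measurable M"
    using assms[of k] by (simp add: inner_axis)
qed

abbreviation gaussian_coords :: "('d::finite \<Rightarrow> real) measure" where
  "gaussian_coords \<equiv> Pi\<^sub>M UNIV (\<lambda>_. std_gaussian)"

text \<open>The heat semigroup \<open>exp (p * \<Delta> / 2)\<close> applied to \<open>g\<close>.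
  Since \<open>sqrt\<close> is odd and continuous on the whole line, this is continuous in every
  real \<open>p\<close> for bounded continuous \<open>g\<close>, so later statements need no
  restriction to \<open>p \<ge> 0\<close>.\<close>

definition gauss_mean :: "(real ^ 'd \<Rightarrow> real) \<Rightarrow> real ^ 'd \<Rightarrow> real \<Rightarrow> real" where
  "gauss_mean g x p = (\<integral>\<zeta>. g (x + sqrt p *\<^sub>R vec_lambda \<zeta>) \<partial>gaussian_coords)"

lemma prob_space_gaussian_coords: "prob_space gaussian_coords"
  by (rule prob_space_PiM) (rule prob_space_std_gaussian)

lemma measurable_gaussian_component [measurable]:
  "(\<lambda>\<zeta>. \<zeta> k) \<in> borel_measurable gaussian_coords"
proof -
  have "(\<lambda>\<zeta>. \<zeta> k) \<in> measurable gaussian_coords std_gaussian" by simp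
  then show ?thesis by simp
qed

lemma measurable_vec_lambda_gaussian [measurable]:
  "vec_lambda \<in> borel_measurable (gaussian_coords :: ('d::finite \<Rightarrow> real) measure)"
  using borel_measurable_vec_lambda[of "\<lambda>\<zeta>. \<zeta>" gaussian_coords] by simp

lemma integrable_gaussian_component: "integrable gaussian_coords (\<lambda>\<zeta>. \<bar>\<zeta> k\<bar>)"
proof -
  have "distr gaussian_coords std_gaussian (\<lambda>\<zeta>. \<zeta> k) = std_gaussian"
    by (rule distr_PiM_component) (auto intro: prob_space_std_gaussian)
  then have "integrable (distr gaussian_coords std_gaussian (\<lambda>\<zeta>. \<zeta> k)) (\<lambda>z. \<bar>z\<bar>)"
    using integrable_std_gaussian_abs by simp
  then show ?thesis
    by (subst (asm) integrable_distr_eq) auto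
qed

lemma vec_lambda_upd: "vec_lambda (\<zeta>(k := y)) = vec_lambda (\<zeta>(k := 0)) + y *\<^sub>R axis k (1::real)"
  by (simp add: vec_eq_iff axis_def)

text \<open>Fubini isolates coordinate \<open>k\<close> and reduces the claim to
  \<open>stein\<close> on lines parallel to that axis; the factor \<open>c\<close> is the inner
  derivative of \<open>c * y\<close>.\<close>

lemma stein_coordinate:
  fixes g :: "real ^ 'd \<Rightarrow> real"
  assumes ex: "\<And>y. partial_exists k g y"
    and contg: "continuous_on UNIV g" and cont: "continuous_on UNIV (partial k g)"
    and A: "\<And>y. \<bar>g y\<bar> \<le> A" and C: "\<And>y. \<bar>partial k g y\<bar> \<le> C"
  shows "(\<integral>\<zeta>. \<zeta> k * g (x + c *\<^sub>R vec_lambda \<zeta>) \<partial>gaussian_coords)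
       = c * (\<integral>\<zeta>. partial k g (x + c *\<^sub>R vec_lambda \<zeta>) \<partial>gaussian_coords)"
proof -
  interpret G: prob_space "gaussian_coords :: ('d \<Rightarrow> real) measure" by (rule prob_space_gaussian_coords)
  interpret S: product_prob_space "\<lambda>_::'d. std_gaussian" UNIV
    by (intro product_prob_spaceI prob_space_std_gaussian)
  have [measurable]: "g \<in> borel_measurable borel" "partial k g \<in> borel_measurable borel"
    using contg cont by (auto intro: borel_measurable_continuous_onI)
  let ?x = "\<lambda>\<zeta>. x + c *\<^sub>R vec_lambda \<zeta>" and ?I = "UNIV - {k}"
  have I: "insert k ?I = UNIV" by auto
  have i1: "integrable gaussian_coords (\<lambda>\<zeta>. \<zeta> k * g (?x \<zeta>))"
  proof (rule Bochner_Integration.integrable_bound)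
    show "integrable gaussian_coords (\<lambda>\<zeta>::'d \<Rightarrow> real. \<bar>\<zeta> k\<bar> * A)"
      by (intro integrable_mult_left integrable_gaussian_component)
  qed (auto intro!: AE_I2 mult_left_mono order_trans[OF A abs_ge_self] simp: abs_mult)
  have i2: "integrable gaussian_coords (\<lambda>\<zeta>. c * partial k g (?x \<zeta>))"
    by (rule G.integrable_const_bound[of _ "\<bar>c\<bar> * C"])
      (auto simp: abs_mult intro!: mult_left_mono C)
  have inner: "(\<integral>y. y * g (?x (\<zeta>(k := y))) \<partial>std_gaussian) = (\<integral>y. c * partial k g (?x (\<zeta>(k := y))) \<partial>std_gaussian)"
    for \<zeta>
  proof (rule stein)
    \<comment> \<open>With the \<open>k\<close>-th Gaussian coordinate set to 0, the dependence on
      \<open>y\<close> is motion along axis \<open>k\<close> starting from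
      \<open>x0\<close>.\<close>
    define x0 where "x0 = x + c *\<^sub>R vec_lambda (\<zeta>(k := 0))"
    have x0: "?x (\<zeta>(k := y)) = x0 + (c * y) *\<^sub>R axis k 1" for y
      unfolding x0_def vec_lambda_upd[of \<zeta> k y] by (simp add: scaleR_add_right)
    fix y
    have "((\<lambda>y. g (x0 + (c * y) *\<^sub>R axis k 1)) has_real_derivative
        partial k g (x0 + (c * y) *\<^sub>R axis k 1) * c) (at y)"
      by (rule DERIV_chain2[where f="\<lambda>r. g (x0 + r *\<^sub>R axis k 1)", OF partial_has_real_derivative[OF ex]])
        (auto intro!: derivative_eq_intros)
    then show "((\<lambda>y. g (?x (\<zeta>(k := y)))) has_real_derivative c * partial k g (?x (\<zeta>(k := y)))) (at y)"
      unfolding x0 by (simp add: mult.commute)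
    show "continuous_on UNIV (\<lambda>y. c * partial k g (?x (\<zeta>(k := y))))"
      unfolding x0 by (intro continuous_intros continuous_on_compose2[OF cont]) auto
    show "\<bar>g (?x (\<zeta>(k := y)))\<bar> \<le> A" by (rule A)
    show "\<bar>c * partial k g (?x (\<zeta>(k := y)))\<bar> \<le> \<bar>c\<bar> * C"
      unfolding abs_mult by (intro mult_left_mono C) simp
  qed
  have "(\<integral>\<zeta>. \<zeta> k * g (?x \<zeta>) \<partial>gaussian_coords)
      = (\<integral>\<zeta>. (\<integral>y. (\<zeta>(k := y)) k * g (?x (\<zeta>(k := y))) \<partial>std_gaussian) \<partial>Pi\<^sub>M ?I (\<lambda>_. std_gaussian))"
    using S.product_integral_insert[of ?I k "\<lambda>\<zeta>. \<zeta> k * g (?x \<zeta>)"] i1 unfolding I by simp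
  also have "\<dots> = (\<integral>\<zeta>. (\<integral>y. c * partial k g (?x (\<zeta>(k := y))) \<partial>std_gaussian) \<partial>Pi\<^sub>M ?I (\<lambda>_. std_gaussian))"
    using inner by simp
  also have "\<dots> = (\<integral>\<zeta>. c * partial k g (?x \<zeta>) \<partial>gaussian_coords)"
    by (rule S.product_integral_insert[of ?I k "\<lambda>\<zeta>. c * partial k g (?x \<zeta>)", unfolded I, OF _ _ i2, symmetric])
      auto
  finally show ?thesis by simp
qed

lemma gauss_mean_bounded:
  assumes "continuous_on UNIV g" "\<And>y. \<bar>g y\<bar> \<le> A"
  shows "\<bar>gauss_mean g x p\<bar> \<le> A"
proof -
  interpret G: prob_space "gaussian_coords :: ('a \<Rightarrow> real) measure" by (rule prob_space_gaussian_coords)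
  have [measurable]: "g \<in> borel_measurable borel"
    using assms(1) by (rule borel_measurable_continuous_onI)
  have i: "integrable gaussian_coords (\<lambda>\<zeta>. g (x + sqrt p *\<^sub>R vec_lambda \<zeta>))"
    by (rule G.integrable_const_bound[of _ A]) (auto intro: assms)
  have "\<bar>gauss_mean g x p\<bar> \<le> (\<integral>\<zeta>. \<bar>g (x + sqrt p *\<^sub>R vec_lambda \<zeta>)\<bar> \<partial>gaussian_coords)"
    unfolding gauss_mean_def by (rule integral_abs_bound)
  also have "\<dots> \<le> A"
    using i by (intro G.integral_le_const) (auto intro: assms)
  finally show ?thesis .
qed

lemma continuous_on_gauss_mean:
  assumes cont: "continuous_on UNIV g" and A: "\<And>y. \<bar>g y\<bar> \<le> A"
  shows "continuous_on UNIV (gauss_mean g x)"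
proof -
  interpret G: prob_space "gaussian_coords :: ('a \<Rightarrow> real) measure" by (rule prob_space_gaussian_coords)
  have [measurable]: "g \<in> borel_measurable borel"
    using cont by (rule borel_measurable_continuous_onI)
  have "(gauss_mean g x \<longlongrightarrow> gauss_mean g x p) (at p)" for p
    unfolding gauss_mean_def
  proof (rule tendsto_integral_dominated[where w="\<lambda>_. A"])
    fix \<zeta> :: "'a \<Rightarrow> real"
    have "continuous_on UNIV (\<lambda>s. g (x + sqrt s *\<^sub>R vec_lambda \<zeta>))"
      by (intro continuous_on_compose2[OF cont] continuous_intros) auto
    then show "((\<lambda>s. g (x + sqrt s *\<^sub>R vec_lambda \<zeta>)) \<longlongrightarrow> g (x + sqrt p *\<^sub>R vec_lambda \<zeta>)) (at p)"
      by (simp add: continuous_on_def)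
  qed (auto intro: A)
  then show ?thesis by (simp add: continuous_on_def)
qed

text \<open>The heat equation: differentiating in \<open>p\<close> produces \<open>\<zeta> \<bullet> \<nabla>g / (2 \<surd>p)\<close>, and Stein's identity
  trades each factor \<open>\<zeta>\<^sub>k\<close> for \<open>\<surd>p\<close> times a further derivative.\<close>

lemma gauss_mean_has_real_derivative:
  fixes g :: "real ^ 'd \<Rightarrow> real"
  assumes ex: "second_partials_exist g"
    and cont: "continuous_on UNIV g" "\<And>k. continuous_on UNIV (partial k g)"
      "\<And>k. continuous_on UNIV (partial k (partial k g))"
    and A: "\<And>y. \<bar>g y\<bar> \<le> A" and C: "\<And>k y. \<bar>partial k g y\<bar> \<le> C"
    and D: "\<And>k y. \<bar>partial k (partial k g) y\<bar> \<le> D"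
    and p: "p > 0"
  shows "(gauss_mean g x has_real_derivative gauss_mean (laplacian g) x p / 2) (at p)"
proof -
  interpret G: prob_space "gaussian_coords :: ('d \<Rightarrow> real) measure" by (rule prob_space_gaussian_coords)
  have [measurable]: "g \<in> borel_measurable borel" "partial k g \<in> borel_measurable borel"
    "partial k (partial k g) \<in> borel_measurable borel" for k
    using cont by (auto intro: borel_measurable_continuous_onI)
  let ?x = "\<lambda>s \<zeta>. x + sqrt s *\<^sub>R vec_lambda \<zeta>"
  let ?g' = "\<lambda>s \<zeta>. (\<Sum>k\<in>UNIV. \<zeta> k * partial k g (?x s \<zeta>)) * (inverse (sqrt s) / 2)"
  have C0: "C \<ge> 0" using C[of undefined undefined] by linarith
  have "(gauss_mean g x has_real_derivative (\<integral>\<zeta>. ?g' p \<zeta> \<partial>gaussian_coords)) (at p)"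
    unfolding gauss_mean_def
  \<comment> \<open>Within \<open>p / 2\<close> of \<open>p\<close> the factor
    \<open>inverse (sqrt s)\<close> is at most its value at \<open>p / 2\<close>, and first absolute
    moments of the Gaussian coordinates make the bound integrable.\<close>
  proof (rule has_real_derivative_integral[where d="p / 2"
        and w="\<lambda>\<zeta>. (\<Sum>k\<in>UNIV. \<bar>\<zeta> k\<bar> * C) * (inverse (sqrt (p / 2)) / 2)"])
    fix s assume "dist s p < p / 2"
    then have s: "s > p / 2" unfolding dist_real_def by linarith
    then have s0: "s > 0" using p by simp
    show "integrable gaussian_coords (\<lambda>\<zeta>. g (?x s \<zeta>))"
      by (rule G.integrable_const_bound[of _ A]) (auto intro: A)
    fix \<zeta> :: "'d \<Rightarrow> real"
    show "((\<lambda>s. g (?x s \<zeta>)) has_real_derivative ?g' s \<zeta>) (at s)"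
      using DERIV_chain2[OF ray_has_real_derivative[of g x "vec_lambda \<zeta>" "sqrt s"] DERIV_real_sqrt[OF s0]]
        ex cont by (simp add: second_partials_exist_def)
    have "inverse (sqrt s) \<le> inverse (sqrt (p / 2))"
      using s p by (intro le_imp_inverse_le) auto
    then show "\<bar>?g' s \<zeta>\<bar> \<le> (\<Sum>k\<in>UNIV. \<bar>\<zeta> k\<bar> * C) * (inverse (sqrt (p / 2)) / 2)"
      unfolding abs_mult using s0 C C0
      by (intro mult_mono order_trans[OF sum_abs] sum_mono) (auto simp: abs_mult intro!: mult_left_mono sum_nonneg)
  qed (use p in \<open>auto intro!: integrable_gaussian_component integrable_mult_left Bochner_Integration.integrable_sum\<close>)
  also have "(\<integral>\<zeta>. ?g' p \<zeta> \<partial>gaussian_coords) =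
      (\<Sum>k\<in>UNIV. (\<integral>\<zeta>. \<zeta> k * partial k g (?x p \<zeta>) \<partial>gaussian_coords)) * (inverse (sqrt p) / 2)"
  proof -
    have "integrable gaussian_coords (\<lambda>\<zeta>. \<zeta> k * partial k g (?x p \<zeta>))" for k
    proof (rule Bochner_Integration.integrable_bound)
      show "integrable gaussian_coords (\<lambda>\<zeta>::'d \<Rightarrow> real. \<bar>\<zeta> k\<bar> * C)"
        by (intro integrable_mult_left integrable_gaussian_component)
    qed (auto intro!: AE_I2 mult_left_mono order_trans[OF C abs_ge_self] simp: abs_mult)
    then show ?thesis by (simp add: Bochner_Integration.integral_sum)
  qed
  also have "(\<Sum>k\<in>UNIV. (\<integral>\<zeta>. \<zeta> k * partial k g (?x p \<zeta>) \<partial>gaussian_coords)) =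
      (\<Sum>k\<in>UNIV. sqrt p * (\<integral>\<zeta>. partial k (partial k g) (?x p \<zeta>) \<partial>gaussian_coords))"
    by (intro sum.cong refl stein_coordinate[OF _ _ _ C D])
      (use ex cont in \<open>auto simp: second_partials_exist_def\<close>)
  also have "\<dots> = sqrt p * gauss_mean (laplacian g) x p"
  proof -
    have "integrable gaussian_coords (\<lambda>\<zeta>. partial k (partial k g) (?x p \<zeta>))" for k
      by (rule G.integrable_const_bound[of _ D]) (auto intro: D)
    then show ?thesis
      by (simp add: gauss_mean_def laplacian_def Bochner_Integration.integral_sum sum_distrib_left)
  qed
  also have "sqrt p * gauss_mean (laplacian g) x p * (inverse (sqrt p) / 2) = gauss_mean (laplacian g) x p / 2"
    using p by (simp add: field_simps)
  finally show ?thesis .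
qed

section \<open>The half-order Caputo derivative of Gaussian mixtures\<close>

lemma (in pair_sigma_finite) integrable_prod_mult:
  fixes f :: "'a \<Rightarrow> real" and g :: "'b \<Rightarrow> real"
  assumes [intro, simp]: "integrable M1 f" "integrable M2 g"
  shows "integrable (M1 \<Otimes>\<^sub>M M2) (\<lambda>x. f (fst x) * g (snd x))"
proof (rule Fubini_integrable)
  have [measurable]: "f \<in> borel_measurable M1" "g \<in> borel_measurable M2"
    by (rule borel_measurable_integrable, fact)+
  show "(\<lambda>x. f (fst x) * g (snd x)) \<in> borel_measurable (M1 \<Otimes>\<^sub>M M2)" by measurable
qed (auto simp: abs_mult intro!: integrable_mult_left)

lemma pair_centred_gaussian_density:
  assumes "sigma_finite_measure M" "\<sigma> > 0"
  shows "M \<Otimes>\<^sub>M centred_gaussian \<sigma> =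
    density (M \<Otimes>\<^sub>M lborel) (\<lambda>x. ennreal (normal_density 0 \<sigma> (snd x)))"
proof -
  interpret M: sigma_finite_measure M by fact
  interpret N: prob_space "density lborel (\<lambda>x. ennreal (normal_density 0 \<sigma> x))"
    using prob_space_normal_density[of \<sigma> 0] assms(2) by simp
  have "density M (\<lambda>_. 1) \<Otimes>\<^sub>M density lborel (\<lambda>x. ennreal (normal_density 0 \<sigma> x)) =
      density (M \<Otimes>\<^sub>M lborel) (\<lambda>(x, y). 1 * ennreal (normal_density 0 \<sigma> y))"
    by (rule pair_measure_density) (auto intro: lborel.sigma_finite_measure_axioms N.sigma_finite_measure_axioms)
  then show ?thesis
    using assms(2) by (simp add: density_1 centred_gaussian_def case_prod_beta')
qed

lemma pair_centred_gaussian_distr: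
  assumes "\<sigma> \<ge> 0"
  shows "M \<Otimes>\<^sub>M centred_gaussian \<sigma> =
    distr (M \<Otimes>\<^sub>M std_gaussian) (M \<Otimes>\<^sub>M borel) (\<lambda>x. (fst x, \<sigma> * snd x))"
proof -
  interpret N: prob_space "distr std_gaussian borel (\<lambda>z. \<sigma> * z)"
    by (rule prob_space.prob_space_distr[OF prob_space_std_gaussian]) simp
  have "distr M M (\<lambda>x. x) \<Otimes>\<^sub>M distr std_gaussian borel (\<lambda>z. \<sigma> * z) =
      distr (M \<Otimes>\<^sub>M std_gaussian) (M \<Otimes>\<^sub>M borel) (\<lambda>(x, y). (x, \<sigma> * y))"
    by (rule pair_measure_distr) (auto intro: N.sigma_finite_measure_axioms)
  then show ?thesis
    by (simp add: centred_gaussian_eq_distr assms case_prod_beta' distr_id)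
qed

text \<open>The change of variables \<open>y = \<sigma> * z\<close>, read off from the two
  descriptions of the product with \<open>centred_gaussian \<sigma>\<close>: as an image and as a
  density. It moves the time from the integrand into the density, where the first passage kernel can
  be recognised.\<close>

lemma integral_pair_std_gaussian:
  fixes h :: "'a \<times> real \<Rightarrow> real"
  assumes "sigma_finite_measure M" "\<sigma> > 0" and h [measurable]: "h \<in> borel_measurable (M \<Otimes>\<^sub>M borel)"
  shows "(\<integral>x. h (fst x, \<sigma> * snd x) \<partial>(M \<Otimes>\<^sub>M std_gaussian)) =
    (\<integral>x. normal_density 0 \<sigma> (snd x) * h x \<partial>(M \<Otimes>\<^sub>M lborel))"
proof -
  have s: "sets (M \<Otimes>\<^sub>M borel) = sets (M \<Otimes>\<^sub>M lborel)"
    by (auto intro!: sets_pair_measure_cong)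
  have m: "(\<lambda>x. (fst x, \<sigma> * snd x)) \<in> measurable (M \<Otimes>\<^sub>M std_gaussian) (M \<Otimes>\<^sub>M borel)"
    by simp
  have h': "h \<in> borel_measurable (M \<Otimes>\<^sub>M lborel)"
    using h measurable_cong_sets[OF s refl] by blast
  have n: "(\<lambda>x. normal_density 0 \<sigma> (snd x)) \<in> borel_measurable (M \<Otimes>\<^sub>M lborel)" by simp
  have "(\<integral>x. h (fst x, \<sigma> * snd x) \<partial>(M \<Otimes>\<^sub>M std_gaussian)) = integral\<^sup>L (M \<Otimes>\<^sub>M centred_gaussian \<sigma>) h"
    using assms(2) by (simp add: pair_centred_gaussian_distr integral_distr[OF m h])
  also have "\<dots> = (\<integral>x. normal_density 0 \<sigma> (snd x) * h x \<partial>(M \<Otimes>\<^sub>M lborel))"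
    unfolding pair_centred_gaussian_density[OF assms(1,2)] by (subst integral_density[OF h' n]) auto
  finally show ?thesis .
qed

text \<open>Strong Markov property in disguise:
  \<open>\<bar>y\<bar> / s * normal_density 0 (sqrt s) y\<close> is the density of the first passage
  time to \<open>y\<close>, and \<open>1 / sqrt (t - s)\<close> is \<open>sqrt (2 * pi)\<close>
  times the density at 0 of a Brownian motion at time \<open>t - s\<close>; a path found at
  \<open>y\<close> at time \<open>t\<close> has first hit \<open>y\<close> and then returned to it.
  At \<open>y = 0\<close> the integral vanishes but the right-hand side does not.\<close>

lemma first_passage_kernel_normal:
  assumes "y \<noteq> 0" "t > 0"
  shows "set_integrable lborel {0<..<t} (\<lambda>s. \<bar>y\<bar> / s * normal_density 0 (sqrt s) y / sqrt (t - s))"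
    and "(LINT s:{0<..<t}|lborel. \<bar>y\<bar> / s * normal_density 0 (sqrt s) y / sqrt (t - s)) =
      sqrt (2 * pi) * normal_density 0 (sqrt t) y"
proof -
  let ?K = "\<lambda>s. \<bar>y\<bar> / (s * sqrt s * sqrt (t - s)) * exp (- \<bar>y\<bar>\<^sup>2 / (2 * s))"
  have eq: "\<bar>y\<bar> / s * normal_density 0 (sqrt s) y / sqrt (t - s) = ?K s / sqrt (2 * pi)"
    if "s \<in> {0<..<t}" for s
    using that by (simp add: normal_density_def real_sqrt_mult)
  note K = first_passage_kernel_integral[of "\<bar>y\<bar>" t]
  have "set_integrable lborel {0<..<t} (\<lambda>s. ?K s / sqrt (2 * pi))"
    using K(1) assms by (intro set_integrable_divide) auto
  then show "set_integrable lborel {0<..<t} (\<lambda>s. \<bar>y\<bar> / s * normal_density 0 (sqrt s) y / sqrt (t - s))"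
    by (rule set_integrable_cong[THEN iffD1, OF refl refl eq[symmetric], rotated -1])
  have "(LINT s:{0<..<t}|lborel. \<bar>y\<bar> / s * normal_density 0 (sqrt s) y / sqrt (t - s)) =
      (LINT s:{0<..<t}|lborel. ?K s / sqrt (2 * pi))"
    by (rule set_lebesgue_integral_cong) (simp, intro allI impI eq)
  also have "\<dots> = sqrt (2 * pi / t) * exp (- \<bar>y\<bar>\<^sup>2 / (2 * t)) / sqrt (2 * pi)"
    by (subst set_integral_divide_zero, subst K(2)) (use assms in auto)
  also have "\<dots> = sqrt (2 * pi) * normal_density 0 (sqrt t) y"
    using assms by (simp add: normal_density_def real_sqrt_mult real_sqrt_divide)
  finally show "(LINT s:{0<..<t}|lborel. \<bar>y\<bar> / s * normal_density 0 (sqrt s) y / sqrt (t - s)) =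
      sqrt (2 * pi) * normal_density 0 (sqrt t) y" .
qed

section \<open>Continuity and time derivative of averages of
  \<open>\<phi> (sqrt s * r)\<close>\<close>

context
  fixes P :: "'a measure" and r :: "'a \<Rightarrow> real" and \<phi> \<psi> :: "real \<Rightarrow> real" and A C :: real
  assumes P: "prob_space P"
    and r: "integrable P r" "\<And>\<omega>. \<omega> \<in> space P \<Longrightarrow> 0 \<le> r \<omega>"
    and phi: "continuous_on UNIV \<phi>" "\<And>p. \<bar>\<phi> p\<bar> \<le> A"
    and psi: "continuous_on UNIV \<psi>" "\<And>p. \<bar>\<psi> p\<bar> \<le> C"
    and deriv: "\<And>p. p > 0 \<Longrightarrow> (\<phi> has_real_derivative \<psi> p / 2) (at p)"
begin

lemma continuous_on_integral_sqrt_time: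
  shows "continuous_on UNIV (\<lambda>s. \<integral>\<omega>. \<phi> (sqrt s * r \<omega>) \<partial>P)"
    and "continuous_on UNIV (\<lambda>s. \<integral>\<omega>. \<psi> (sqrt s * r \<omega>) * r \<omega> \<partial>P)"
proof -
  interpret prob_space P by (rule P)
  have [measurable]: "r \<in> borel_measurable P" "\<phi> \<in> borel_measurable borel" "\<psi> \<in> borel_measurable borel"
    using r phi psi by (auto intro: borel_measurable_continuous_onI)
  have c: "continuous_on UNIV (\<lambda>s. \<phi> (sqrt s * r \<omega>))" "continuous_on UNIV (\<lambda>s. \<psi> (sqrt s * r \<omega>) * r \<omega>)" for \<omega>
    by (intro continuous_intros continuous_on_compose2[OF phi(1)] continuous_on_compose2[OF psi(1)]; simp)+
  have "((\<lambda>s. \<integral>\<omega>. \<phi> (sqrt s * r \<omega>) \<partial>P) \<longlongrightarrow> (\<integral>\<omega>. \<phi> (sqrt a * r \<omega>) \<partial>P)) (at a)" for a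
    by (rule tendsto_integral_dominated[where w="\<lambda>_. A"])
      (use c(1) phi(2) in \<open>auto simp: continuous_on_def\<close>)
  then show "continuous_on UNIV (\<lambda>s. \<integral>\<omega>. \<phi> (sqrt s * r \<omega>) \<partial>P)" by (simp add: continuous_on_def)
  have "((\<lambda>s. \<integral>\<omega>. \<psi> (sqrt s * r \<omega>) * r \<omega> \<partial>P) \<longlongrightarrow> (\<integral>\<omega>. \<psi> (sqrt a * r \<omega>) * r \<omega> \<partial>P)) (at a)" for a
  proof (rule tendsto_integral_dominated[where w="\<lambda>\<omega>. C * r \<omega>"])
    show "\<bar>\<psi> (sqrt s * r \<omega>) * r \<omega>\<bar> \<le> C * r \<omega>" if "\<omega> \<in> space P" for s \<omega>
      using r(2)[OF that] by (simp add: abs_mult mult_right_mono psi(2))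
  qed (use c(2) r(1) in \<open>auto simp: continuous_on_def\<close>)
  then show "continuous_on UNIV (\<lambda>s. \<integral>\<omega>. \<psi> (sqrt s * r \<omega>) * r \<omega> \<partial>P)" by (simp add: continuous_on_def)
qed

text \<open>The 4 combines the 1/2 of \<open>deriv\<close> with the 1/2 from differentiating
  \<open>sqrt s\<close>. The derivative is of order \<open>1 / sqrt s\<close> near 0, hence
  domination is set up only within \<open>s0 / 2\<close> of \<open>s0\<close>.\<close>

lemma integral_sqrt_time_has_real_derivative:
  assumes s0: "s0 > 0"
  shows "((\<lambda>s. \<integral>\<omega>. \<phi> (sqrt s * r \<omega>) \<partial>P) has_real_derivative
    (\<integral>\<omega>. \<psi> (sqrt s0 * r \<omega>) * r \<omega> \<partial>P) / (4 * sqrt s0)) (at s0)"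
proof -
  interpret prob_space P by (rule P)
  have [measurable]: "r \<in> borel_measurable P" "\<phi> \<in> borel_measurable borel" "\<psi> \<in> borel_measurable borel"
    using r phi psi by (auto intro: borel_measurable_continuous_onI)
  have C0: "C \<ge> 0" using psi(2)[of 0] by linarith
  let ?g' = "\<lambda>s \<omega>. (\<psi> (sqrt s * r \<omega>) * r \<omega>) / (4 * sqrt s)"
  have "((\<lambda>s. \<integral>\<omega>. \<phi> (sqrt s * r \<omega>) \<partial>P) has_real_derivative (\<integral>\<omega>. ?g' s0 \<omega> \<partial>P)) (at s0)"
  proof (rule has_real_derivative_integral[where d="s0 / 2" and w="\<lambda>\<omega>. C * r \<omega> / (4 * sqrt (s0 / 2))"])
    fix s assume "dist s s0 < s0 / 2"
    then have s: "s > s0 / 2" unfolding dist_real_def by linarith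
    then have sp: "s > 0" using s0 by simp
    show "integrable P (\<lambda>\<omega>. \<phi> (sqrt s * r \<omega>))"
      by (rule integrable_const_bound[of _ A]) (auto intro: phi)
    fix \<omega> assume "\<omega> \<in> space P"
    then have r0: "r \<omega> \<ge> 0" by (rule r)
    show "((\<lambda>s. \<phi> (sqrt s * r \<omega>)) has_real_derivative ?g' s \<omega>) (at s)"
    \<comment> \<open>\<open>deriv\<close> speaks only of \<open>p > 0\<close>. Where
      \<open>r \<omega> = 0\<close> the integrand is constant in \<open>s\<close> and the claimed
      derivative is 0.\<close>
    proof (cases "r \<omega> = 0")
      case False
      have sq: "((\<lambda>s. sqrt s * r \<omega>) has_real_derivative inverse (sqrt s) / 2 * r \<omega>) (at s)"
        using DERIV_real_sqrt[OF sp] by (rule DERIV_cmult_right)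
      have "0 < sqrt s * r \<omega>" using False r0 sp by simp
      note DERIV_chain2[OF deriv[OF this] sq]
      then show ?thesis by (rule DERIV_cong) (use sp in \<open>simp add: field_simps\<close>)
    qed simp
    have "C * r \<omega> / (4 * sqrt s) \<le> C * r \<omega> / (4 * sqrt (s0 / 2))"
      using s s0 C0 r0 by (intro divide_left_mono mult_left_mono mult_nonneg_nonneg mult_pos_pos) auto
    moreover have "\<bar>?g' s \<omega>\<bar> \<le> C * r \<omega> / (4 * sqrt s)"
      using r0 sp by (simp add: abs_mult divide_right_mono mult_right_mono psi(2))
    ultimately show "\<bar>?g' s \<omega>\<bar> \<le> C * r \<omega> / (4 * sqrt (s0 / 2))" by simp
  qed (use s0 r in auto)
  then show ?thesis by simp
qed

end

text \<open>In the variable \<open>y = sqrt s * z\<close> the integrand separates into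
  \<open>G / 4\<close>, free of \<open>s\<close>, and the kernel \<open>k\<close>, whose
  \<open>s\<close>-integral is known. Fubini is justified because \<open>\<bar>G\<bar>\<close> is at
  most \<open>C * Q\<close> and the integrated kernel is bounded by a multiple of a normal density
  in \<open>y\<close>, so the bound is a product of integrable functions.\<close>

lemma half_integral_gaussian_mixture:
  fixes M :: "'a measure" and Q :: "'a \<Rightarrow> real" and \<psi> :: "real \<Rightarrow> real"
  assumes M: "prob_space M" and Q: "integrable M Q" "\<And>\<omega>. \<omega> \<in> space M \<Longrightarrow> 0 \<le> Q \<omega>"
    and psi: "continuous_on UNIV \<psi>" "\<And>p. \<bar>\<psi> p\<bar> \<le> C"
    and t: "t > 0"
  defines "r \<equiv> \<lambda>x. \<bar>snd x\<bar> * Q (fst x)"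
  defines "D \<equiv> \<lambda>s. (\<integral>x. \<psi> (sqrt s * r x) * r x \<partial>(M \<Otimes>\<^sub>M std_gaussian)) / (4 * sqrt s)"
  shows "set_integrable lborel {0<..<t} (\<lambda>s. D s / sqrt (t - s))"
    and "(LINT s:{0<..<t}|lborel. D s / sqrt (t - s)) =
      sqrt (2 * pi) / 4 * (\<integral>x. \<psi> (sqrt t * r x) * Q (fst x) \<partial>(M \<Otimes>\<^sub>M std_gaussian))"
proof -
  interpret M: prob_space M by (rule M)
  interpret N: pair_sigma_finite M lborel ..
  interpret R: pair_sigma_finite "M \<Otimes>\<^sub>M lborel" lborel ..
  have sM: "sigma_finite_measure M" ..
  have [measurable]: "Q \<in> borel_measurable M" "\<psi> \<in> borel_measurable borel"
    using Q psi by (auto intro: borel_measurable_continuous_onI)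
  define G where "G x = \<psi> (\<bar>snd x\<bar> * Q (fst x)) * Q (fst x)" for x :: "'a \<times> real"
  define k where "k y s = indicator {0<..<t} s * (\<bar>y\<bar> / s * normal_density 0 (sqrt s) y / sqrt (t - s))"
    for y s :: real
  define F where "F x s = G x / 4 * k (snd x) s" for x :: "'a \<times> real" and s
  have k0: "k y s \<ge> 0" for y s by (auto simp: k_def indicator_def)
  have ki: "integrable lborel (k y)" for y
  proof (cases "y = 0")
    case False
    from first_passage_kernel_normal(1)[OF this t] show ?thesis by (simp add: set_integrable_def k_def[abs_def])
  qed (simp add: k_def[abs_def])
  have kI: "integral\<^sup>L lborel (k y) = sqrt (2 * pi) * normal_density 0 (sqrt t) y" if "y \<noteq> 0" for y
    using first_passage_kernel_normal(2)[OF that t] by (simp add: set_lebesgue_integral_def k_def[abs_def])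
  \<comment> \<open>As an inequality the formula survives at \<open>y = 0\<close>, where
    \<open>k\<close> vanishes; domination then needs no exceptional set.\<close>
  have kle: "integral\<^sup>L lborel (k y) \<le> sqrt (2 * pi) * normal_density 0 (sqrt t) y" for y
    using kI[of y] by (cases "y = 0") (simp_all add: k_def[abs_def])
  have [measurable]: "G \<in> borel_measurable (M \<Otimes>\<^sub>M lborel)" "G \<in> borel_measurable (M \<Otimes>\<^sub>M borel)"
    unfolding G_def[abs_def] by measurable
  have [measurable]: "(\<lambda>x. F (fst x) (snd x)) \<in> borel_measurable ((M \<Otimes>\<^sub>M lborel) \<Otimes>\<^sub>M lborel)"
    unfolding F_def k_def normal_density_def by measurable
  have Gle: "\<bar>G x\<bar> \<le> C * Q (fst x)" if "x \<in> space (M \<Otimes>\<^sub>M lborel)" for x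
  proof -
    have "Q (fst x) \<ge> 0" using that Q(2) by (auto simp: space_pair_measure)
    then show ?thesis by (simp add: G_def abs_mult mult_right_mono psi(2))
  qed
  have Fint: "integrable ((M \<Otimes>\<^sub>M lborel) \<Otimes>\<^sub>M lborel) (\<lambda>x. F (fst x) (snd x))"
  proof (rule R.Fubini_integrable)
    have "integrable (M \<Otimes>\<^sub>M lborel) (\<lambda>x. (C * Q (fst x)) * (sqrt (2 * pi) / 4 * normal_density 0 (sqrt t) (snd x)))"
      by (rule N.integrable_prod_mult[of "\<lambda>\<omega>. C * Q \<omega>" "\<lambda>y. sqrt (2 * pi) / 4 * normal_density 0 (sqrt t) y"])
        (use Q t in auto)
    then show "integrable (M \<Otimes>\<^sub>M lborel) (\<lambda>x. \<integral>y. norm (F (fst (x, y)) (snd (x, y))) \<partial>lborel)"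
    proof (rule Bochner_Integration.integrable_bound)
      show "(\<lambda>x. \<integral>y. norm (F (fst (x, y)) (snd (x, y))) \<partial>lborel) \<in> borel_measurable (M \<Otimes>\<^sub>M lborel)"
        by (rule lborel.borel_measurable_lebesgue_integral) (simp add: case_prod_beta')
      show "AE x in M \<Otimes>\<^sub>M lborel. norm (\<integral>y. norm (F (fst (x, y)) (snd (x, y))) \<partial>lborel)
          \<le> norm ((C * Q (fst x)) * (sqrt (2 * pi) / 4 * normal_density 0 (sqrt t) (snd x)))"
      proof (rule AE_I2)
        fix x :: "'a \<times> real" assume x: "x \<in> space (M \<Otimes>\<^sub>M lborel)"
        have "(\<integral>y. norm (F (fst (x, y)) (snd (x, y))) \<partial>lborel) = \<bar>G x\<bar> / 4 * integral\<^sup>L lborel (k (snd x))"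
          by (simp add: F_def abs_mult k0)
        also have "\<dots> \<le> (C * Q (fst x)) / 4 * (sqrt (2 * pi) * normal_density 0 (sqrt t) (snd x))"
          using Gle[OF x] kle[of "snd x"] order_trans[OF abs_ge_zero Gle[OF x]]
          by (intro mult_mono) (auto intro!: Bochner_Integration.integral_nonneg k0)
        finally have "(\<integral>y. norm (F (fst (x, y)) (snd (x, y))) \<partial>lborel)
            \<le> (C * Q (fst x)) * (sqrt (2 * pi) / 4 * normal_density 0 (sqrt t) (snd x))"
          by (simp add: mult_ac)
        moreover have "0 \<le> (\<integral>y. norm (F (fst (x, y)) (snd (x, y))) \<partial>lborel)"
          by (rule Bochner_Integration.integral_nonneg) simp
        ultimately show "norm (\<integral>y. norm (F (fst (x, y)) (snd (x, y))) \<partial>lborel)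
            \<le> norm ((C * Q (fst x)) * (sqrt (2 * pi) / 4 * normal_density 0 (sqrt t) (snd x)))"
          by simp
      qed
    qed
    show "AE x in M \<Otimes>\<^sub>M lborel. integrable lborel (\<lambda>y. F (fst (x, y)) (snd (x, y)))"
      by (simp add: F_def ki)
  qed simp
  have D: "indicator {0<..<t} s *\<^sub>R (D s / sqrt (t - s)) = (\<integral>x. F x s \<partial>(M \<Otimes>\<^sub>M lborel))" for s
  proof (cases "s \<in> {0<..<t}")
    case True
    then have s: "s > 0" "s < t" by auto
    \<comment> \<open>With \<open>y = sqrt s * z\<close> the factor \<open>r\<close> is
      \<open>\<bar>y\<bar> * Q / sqrt s\<close>; together with the \<open>1 / (4 * sqrt s)\<close>
      in \<open>D\<close> it produces \<open>\<bar>y\<bar> / s\<close> and the 1/4.\<close>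
    have "(\<integral>x. \<psi> (sqrt s * r x) * r x \<partial>(M \<Otimes>\<^sub>M std_gaussian)) =
        (\<integral>x. (\<lambda>x. G x * \<bar>snd x\<bar> / sqrt s) (fst x, sqrt s * snd x) \<partial>(M \<Otimes>\<^sub>M std_gaussian))"
      using s by (intro Bochner_Integration.integral_cong) (auto simp: G_def r_def abs_mult mult_ac)
    also have "\<dots> = (\<integral>x. normal_density 0 (sqrt s) (snd x) * (G x * \<bar>snd x\<bar> / sqrt s) \<partial>(M \<Otimes>\<^sub>M lborel))"
      by (rule integral_pair_std_gaussian[OF sM]) (use s in auto)
    finally have "D s / sqrt (t - s) =
        (\<integral>x. normal_density 0 (sqrt s) (snd x) * (G x * \<bar>snd x\<bar> / sqrt s) / (4 * sqrt s * sqrt (t - s)) \<partial>(M \<Otimes>\<^sub>M lborel))"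
      unfolding D_def by simp
    also have "\<dots> = (\<integral>x. F x s \<partial>(M \<Otimes>\<^sub>M lborel))"
      using True s by (intro Bochner_Integration.integral_cong) (auto simp: F_def k_def field_simps)
    finally show ?thesis using True by simp
  qed (simp add: F_def k_def)
  have Fint': "integrable ((M \<Otimes>\<^sub>M lborel) \<Otimes>\<^sub>M lborel) (\<lambda>(x, s). F x s)"
    using Fint by (simp add: case_prod_beta')
  show "set_integrable lborel {0<..<t} (\<lambda>s. D s / sqrt (t - s))"
    unfolding set_integrable_def D by (rule R.integrable_snd[OF Fint'])
  have "(LINT s:{0<..<t}|lborel. D s / sqrt (t - s)) = (\<integral>s. (\<integral>x. F x s \<partial>(M \<Otimes>\<^sub>M lborel)) \<partial>lborel)"
    unfolding set_lebesgue_integral_def D ..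
  also have "\<dots> = (\<integral>x. (\<integral>s. F x s \<partial>lborel) \<partial>(M \<Otimes>\<^sub>M lborel))"
    by (rule R.Fubini_integral[OF Fint'])
  also have "\<dots> = (\<integral>x. sqrt (2 * pi) / 4 * (normal_density 0 (sqrt t) (snd x) * G x) \<partial>(M \<Otimes>\<^sub>M lborel))"
  proof (rule integral_cong_AE)
    \<comment> \<open>The exact value \<open>kI\<close> is wrong at \<open>y = 0\<close>, a null
      set.\<close>
    have "AE x in M \<Otimes>\<^sub>M lborel. snd x \<noteq> (0::real)"
    proof (rule N.AE_pair_measure)
      show "{x \<in> space (M \<Otimes>\<^sub>M lborel). snd x \<noteq> (0::real)} \<in> sets (M \<Otimes>\<^sub>M lborel)" by measurable
    qed (use AE_lborel_singleton[of "0::real"] in simp)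
    then show "AE x in M \<Otimes>\<^sub>M lborel. (\<integral>s. F x s \<partial>lborel) = sqrt (2 * pi) / 4 * (normal_density 0 (sqrt t) (snd x) * G x)"
      by eventually_elim (simp add: F_def kI)
    show "(\<lambda>x. \<integral>s. F x s \<partial>lborel) \<in> borel_measurable (M \<Otimes>\<^sub>M lborel)"
      by (rule lborel.borel_measurable_lebesgue_integral) (simp add: case_prod_beta')
  qed simp
  also have "\<dots> = sqrt (2 * pi) / 4 * (\<integral>x. G (fst x, sqrt t * snd x) \<partial>(M \<Otimes>\<^sub>M std_gaussian))"
    by (subst integral_pair_std_gaussian[OF sM]) (use t in auto)
  also have "(\<integral>x. G (fst x, sqrt t * snd x) \<partial>(M \<Otimes>\<^sub>M std_gaussian)) =
      (\<integral>x. \<psi> (sqrt t * r x) * Q (fst x) \<partial>(M \<Otimes>\<^sub>M std_gaussian))"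
    using t by (simp add: G_def r_def abs_mult mult.assoc)
  finally show "(LINT s:{0<..<t}|lborel. D s / sqrt (t - s)) =
      sqrt (2 * pi) / 4 * (\<integral>x. \<psi> (sqrt t * r x) * Q (fst x) \<partial>(M \<Otimes>\<^sub>M std_gaussian))" .
qed

text \<open>\<open>v\<close> is tied to the mixture only for \<open>s \<ge> 0\<close>, the times at
  which the processes live; derivatives at \<open>s > 0\<close> depend on the open half-line alone,
  so they can be read off from the mixture.\<close>

lemma caputo_half_gaussian_mixture:
  fixes M :: "'a measure" and Q :: "'a \<Rightarrow> real" and \<phi> \<psi> v :: "real \<Rightarrow> real"
  assumes M: "prob_space M" and Q: "integrable M Q" "\<And>\<omega>. \<omega> \<in> space M \<Longrightarrow> 0 \<le> Q \<omega>"
    and phi: "continuous_on UNIV \<phi>" "\<And>p. \<bar>\<phi> p\<bar> \<le> A"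
    and psi: "continuous_on UNIV \<psi>" "\<And>p. \<bar>\<psi> p\<bar> \<le> C"
    and deriv: "\<And>p. p > 0 \<Longrightarrow> (\<phi> has_real_derivative \<psi> p / 2) (at p)"
    and v: "\<And>s. s \<ge> 0 \<Longrightarrow> v s = (\<integral>x. \<phi> (sqrt s * (\<bar>snd x\<bar> * Q (fst x))) \<partial>(M \<Otimes>\<^sub>M std_gaussian))"
    and t: "t > 0"
  shows "caputo_exists (1/2) v t"
    and "caputo_deriv (1/2) v t =
      1 / sqrt 8 * (\<integral>x. \<psi> (sqrt t * (\<bar>snd x\<bar> * Q (fst x))) * Q (fst x) \<partial>(M \<Otimes>\<^sub>M std_gaussian))"
proof -
  interpret M: prob_space M by (rule M)
  interpret S: prob_space std_gaussian by (rule prob_space_std_gaussian)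
  interpret MS: pair_prob_space M std_gaussian ..
  let ?P = "M \<Otimes>\<^sub>M std_gaussian"
  let ?r = "\<lambda>x. \<bar>snd x\<bar> * Q (fst x)"
  define D where "D s = (\<integral>x. \<psi> (sqrt s * ?r x) * ?r x \<partial>?P) / (4 * sqrt s)" for s
  have "integrable ?P (\<lambda>x. Q (fst x) * \<bar>snd x\<bar>)"
    by (rule MS.integrable_prod_mult[of Q "\<lambda>z. \<bar>z\<bar>", OF Q(1) integrable_std_gaussian_abs])
  then have r: "integrable ?P ?r" by (simp add: mult.commute)
  have r0: "x \<in> space ?P \<Longrightarrow> 0 \<le> ?r x" for x
    using Q(2) by (auto simp: space_pair_measure)
  note props = MS.prob_space_axioms r r0 phi psi deriv
  have der: "(v has_real_derivative D s) (at s)" if s: "s > 0" for s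
  proof (rule has_field_derivative_transform_within_open[where S="{0<..}"])
    show "((\<lambda>s. \<integral>x. \<phi> (sqrt s * ?r x) \<partial>?P) has_real_derivative D s) (at s)"
      unfolding D_def by (rule integral_sqrt_time_has_real_derivative[OF props s])
  qed (use s v in auto)
  then have dv: "deriv v s = D s" if "s > 0" for s
    using that by (blast intro: DERIV_imp_deriv)
  have contD: "continuous_on {0<..} D"
    unfolding D_def
    by (intro continuous_intros continuous_on_subset[OF continuous_on_integral_sqrt_time(2)[OF props]]) auto
  have eq: "deriv v s / (t - s) powr (1/2) = D s / sqrt (t - s)" if "s \<in> {0<..<t}" for s
    using that dv by (simp add: powr_half_sqrt)
  have half: "set_integrable lborel {0<..<t} (\<lambda>s. D s / sqrt (t - s))"
    "(LINT s:{0<..<t}|lborel. D s / sqrt (t - s)) =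
      sqrt (2 * pi) / 4 * (\<integral>x. \<psi> (sqrt t * ?r x) * Q (fst x) \<partial>?P)"
    unfolding D_def using half_integral_gaussian_mixture[OF M Q psi t] by simp_all
  have "continuous_on {0..} (\<lambda>s. \<integral>x. \<phi> (sqrt s * ?r x) \<partial>?P)"
    by (rule continuous_on_subset[OF continuous_on_integral_sqrt_time(1)[OF props]]) auto
  then have "continuous_on {0..} v"
    by (rule continuous_on_cong[THEN iffD1, OF refl, rotated]) (simp add: v)
  moreover have "\<forall>s>0. v field_differentiable at s"
    using der by (auto simp: field_differentiable_def)
  moreover have "continuous_on {0<..} (deriv v)"
    using contD by (rule continuous_on_cong[THEN iffD1, OF refl, rotated]) (simp add: dv)
  moreover have "set_integrable lborel {0<..<t} (\<lambda>s. deriv v s / (t - s) powr (1/2))"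
    by (rule set_integrable_cong[THEN iffD1, OF refl refl _ half(1)]) (simp add: eq)
  ultimately show "caputo_exists (1/2) v t" by (simp add: caputo_exists_def)
  have "(LINT s:{0<..<t}|lborel. deriv v s / (t - s) powr (1/2)) = (LINT s:{0<..<t}|lborel. D s / sqrt (t - s))"
    by (rule set_lebesgue_integral_cong) (simp, intro allI impI eq)
  note L = this[unfolded half(2)]
  let ?X = "\<integral>x. \<psi> (sqrt t * ?r x) * Q (fst x) \<partial>?P"
  \<comment> \<open>\<open>Gamma (1/2) = sqrt pi\<close> cancels against
    \<open>sqrt (2 * pi) / 4\<close>.\<close>
  have "1 / Gamma (1 - 1 / 2) * (sqrt (2 * pi) / 4 * ?X) = sqrt 2 / 4 * ?X"
    by (simp add: Gamma_one_half_real real_sqrt_mult)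
  also have "sqrt 2 / 4 = 1 / sqrt 8"
    using real_sqrt_mult[of 4 2] by (simp add: field_simps)
  finally show "caputo_deriv (1/2) v t = 1 / sqrt 8 * ?X"
    unfolding caputo_deriv_def L .
qed

section \<open>Evaluation at random times\<close>

text \<open>\<open>process_sigma\<close> retains only the sets; as a measure, the generated
  sigma-algebra can be the source in statements of measurability.\<close>

abbreviation process_algebra ::
  "'w measure \<Rightarrow> 'i set \<Rightarrow> ('i \<Rightarrow> 'w \<Rightarrow> 'b::topological_space) \<Rightarrow> 'w measure" where
  "process_algebra M T X \<equiv> vimage_algebra (space M) (\<lambda>\<omega>. \<lambda>t\<in>T. X t \<omega>) (Pi\<^sub>M T (\<lambda>_. borel))"

lemma process_measurable:
  assumes "t \<in> T"
  shows "X t \<in> borel_measurable (process_algebra M T X)"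
proof -
  have "(\<lambda>\<omega>. \<lambda>t\<in>T. X t \<omega>) \<in> measurable (process_algebra M T X) (Pi\<^sub>M T (\<lambda>_. borel))"
    by (rule measurable_vimage_algebra1) (auto simp: space_PiM)
  from measurable_compose[OF this measurable_component_singleton[OF assms]]
  show ?thesis using assms by simp
qed

text \<open>Preimages under \<open>X i\<close> lie in \<open>N i\<close>, so independence is
  inherited. This is the passage from independence of whole processes to independence of their
  values at fixed times.\<close>

lemma (in prob_space) indep_vars_of_algebras:
  assumes indep: "indep_sets (\<lambda>i. sets (N i)) I"
    and N: "\<And>i. i \<in> I \<Longrightarrow> space (N i) = space M" "\<And>i. i \<in> I \<Longrightarrow> X i \<in> measurable (N i) (M' i)"
  shows "indep_vars M' X I"
  unfolding indep_vars_def2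
proof (intro conjI ballI)
  have sub: "{X i -` A \<inter> space M |A. A \<in> sets (M' i)} \<subseteq> sets (N i)" if "i \<in> I" for i
    using measurable_sets[OF N(2)[OF that]] N(1)[OF that] by auto
  show "indep_sets (\<lambda>i. {X i -` A \<inter> space M |A. A \<in> sets (M' i)}) I"
    by (rule indep_sets_mono_sets[OF indep sub])
  fix i assume i: "i \<in> I"
  have "sets (N i) \<subseteq> events" using indep i by (auto simp: indep_sets_def)
  then show "random_variable (M' i) (X i)"
    using sub[OF i] N(1)[OF i] measurable_space[OF N(2)[OF i]] by (auto intro!: measurableI)
qed

lemma (in prob_space) indep_var_of_algebras:
  assumes indep: "indep_set (sets N1) (sets N2)"
    and N: "space N1 = space M" "space N2 = space M"
    and X: "X \<in> measurable N1 S" "Y \<in> measurable N2 T"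
  shows "indep_var S X T Y"
  unfolding indep_var_def
proof (rule indep_vars_of_algebras[where N="case_bool N1 N2"])
  show "indep_sets (\<lambda>i. sets (case_bool N1 N2 i)) UNIV"
    using indep unfolding indep_set_def by (rule indep_sets_mono_sets) (auto split: bool.split)
qed (use N X in \<open>auto split: bool.split\<close>)

text \<open>Disintegration along a random time: the time \<open>Y\<close> is approximated by finitely valued times,
  for which independence of the individual variables \<open>W v\<close> suffices; continuity of the paths and
  of the test function permits passing to the limit.\<close>

lemma (in prob_space)
  fixes W :: "real ^ 'n \<Rightarrow> 'a \<Rightarrow> real ^ 'd" and Y :: "'a \<Rightarrow> real ^ 'n"
    and F :: "real ^ 'n \<Rightarrow> real" and h :: "real ^ 'd \<Rightarrow> real"
  assumes Wm: "\<And>v. v \<in> orthant \<Longrightarrow> W v \<in> borel_measurable M"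
    and path: "\<And>\<omega>. \<omega> \<in> space M \<Longrightarrow> continuous_on orthant (\<lambda>v. W v \<omega>)"
    and Y [measurable]: "Y \<in> borel_measurable M" and Yo: "\<And>\<omega>. \<omega> \<in> space M \<Longrightarrow> Y \<omega> \<in> orthant"
  shows borel_measurable_random_time: "(\<lambda>\<omega>. W (Y \<omega>) \<omega>) \<in> borel_measurable M" (is ?m)
    and integral_random_time:
      "(\<And>v (G :: real ^ 'n \<Rightarrow> real). v \<in> orthant \<Longrightarrow> G \<in> borel_measurable borel \<Longrightarrow>
          indep_var borel (\<lambda>\<omega>. G (Y \<omega>)) borel (\<lambda>\<omega>. h (W v \<omega>))) \<Longrightarrow>
       F \<in> borel_measurable borel \<Longrightarrow> integrable M (\<lambda>\<omega>. F (Y \<omega>)) \<Longrightarrow>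
       continuous_on UNIV h \<Longrightarrow> (\<And>y. \<bar>h y\<bar> \<le> A) \<Longrightarrow>
       continuous_on UNIV \<Phi> \<Longrightarrow> (\<And>v. v \<in> orthant \<Longrightarrow> (\<integral>\<omega>. h (W v \<omega>) \<partial>M) = \<Phi> v) \<Longrightarrow>
       (\<integral>\<omega>. F (Y \<omega>) * h (W (Y \<omega>) \<omega>) \<partial>M) = (\<integral>\<omega>. F (Y \<omega>) * \<Phi> (Y \<omega>) \<partial>M)"
      (is "PROP ?I")
proof -
  obtain s :: "nat \<Rightarrow> real ^ 'n \<Rightarrow> real ^ 'n" where s: "\<And>i. simple_function borel (s i)" "\<And>y. (\<lambda>i. s i y) \<longlonglongrightarrow> y"
    using borel_measurable_implies_sequence_metric[of "\<lambda>y::real ^ 'n. y" borel 0] by auto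
  \<comment> \<open>The simple functions may leave the orthant, where nothing is known about
    \<open>W\<close>. Coordinatewise absolute values bring them back and do not change the limit,
    since \<open>Y\<close> is in the orthant.\<close>
  define a :: "nat \<Rightarrow> real ^ 'n \<Rightarrow> real ^ 'n" where "a i y = (\<chi> k. \<bar>s i y $ k\<bar>)" for i y
  have ao: "a i y \<in> orthant" for i y by (simp add: a_def orthant_def)
  have fin: "finite (range (a i))" for i
  proof -
    have "range (a i) = (\<lambda>y. \<chi> k. \<bar>y $ k\<bar>) ` range (s i)" by (auto simp: a_def)
    then show ?thesis using simple_functionD(1)[OF s(1)] by simp
  qed
  have sm: "s i \<in> borel_measurable borel" for i
    using s(1) by (rule borel_measurable_simple_function)
  have am [measurable]: "a i \<in> borel_measurable borel" for i
    unfolding a_def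
    by (intro borel_measurable_vec_lambda borel_measurable_abs measurable_compose[OF sm borel_measurable_vec_nth])
  have alim: "(\<lambda>i. a i (Y \<omega>)) \<longlonglongrightarrow> Y \<omega>" if "\<omega> \<in> space M" for \<omega>
  proof -
    have "(\<lambda>i. a i (Y \<omega>)) \<longlonglongrightarrow> (\<chi> k. \<bar>Y \<omega> $ k\<bar>)"
      unfolding a_def by (intro tendsto_vec_lambda tendsto_rabs tendsto_vec_nth s(2))
    also have "(\<chi> k. \<bar>Y \<omega> $ k\<bar>) = Y \<omega>"
      using Yo[OF that] by (simp add: orthant_def vec_eq_iff)
    finally show ?thesis .
  qed
  have Wlim: "(\<lambda>i. W (a i (Y \<omega>)) \<omega>) \<longlonglongrightarrow> W (Y \<omega>) \<omega>" if "\<omega> \<in> space M" for \<omega>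
    using continuous_on_tendsto_compose[OF path[OF that] alim[OF that] Yo[OF that]] ao by simp
  define e where "e i v y = (if a i y = v then 1 else 0 :: real)" for i v y
  have em [measurable]: "e i v \<in> borel_measurable borel" for i v
    unfolding e_def by measurable
  \<comment> \<open>Expansion over the finitely many values of \<open>a i\<close>, with indicator
    coefficients \<open>e i v\<close>. It is stated for any \<open>g\<close>, as it is applied to
    paths of \<open>W\<close>, to \<open>h\<close> along them and to \<open>\<Phi>\<close>.\<close>
  have split: "g (a i y) = (\<Sum>v\<in>range (a i). e i v y *\<^sub>R g v)" for g :: "_ \<Rightarrow> 'z::real_vector" and i y
    using fin[of i] by (simp add: e_def if_distrib[of "\<lambda>c. c *\<^sub>R _"] sum.delta cong: if_cong)
  have aW [measurable]: "(\<lambda>\<omega>. W (a i (Y \<omega>)) \<omega>) \<in> borel_measurable M" for i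
  proof -
    have [measurable]: "v \<in> range (a i) \<Longrightarrow> W v \<in> borel_measurable M" for v using Wm ao by auto
    show ?thesis
      unfolding split[of "\<lambda>v. W v _"] by measurable
  qed
  show m: ?m
    by (rule borel_measurable_LIMSEQ_metric[OF aW Wlim])
  show "PROP ?I"
  proof -
    assume indep: "\<And>v (G :: real ^ 'n \<Rightarrow> real). v \<in> orthant \<Longrightarrow> G \<in> borel_measurable borel \<Longrightarrow>
          indep_var borel (\<lambda>\<omega>. G (Y \<omega>)) borel (\<lambda>\<omega>. h (W v \<omega>))"
      and F [measurable]: "F \<in> borel_measurable borel" and Fi: "integrable M (\<lambda>\<omega>. F (Y \<omega>))"
      and h: "continuous_on UNIV h" and A: "\<And>y. \<bar>h y\<bar> \<le> A"
      and Phi: "continuous_on UNIV \<Phi>" "\<And>v. v \<in> orthant \<Longrightarrow> (\<integral>\<omega>. h (W v \<omega>) \<partial>M) = \<Phi> v"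
    have [measurable]: "h \<in> borel_measurable borel" "\<Phi> \<in> borel_measurable borel"
      using h Phi by (auto intro: borel_measurable_continuous_onI)
    \<comment> \<open>The bound holds on the orthant because \<open>\<Phi>\<close> is an expectation
      of \<open>h\<close> there; this is enough since \<open>a i\<close> takes its values in the
      orthant.\<close>
    have Phi_le: "\<bar>\<Phi> v\<bar> \<le> A" if "v \<in> orthant" for v
    proof -
      have [measurable]: "W v \<in> borel_measurable M" by (rule Wm[OF that])
      have "integrable M (\<lambda>\<omega>. h (W v \<omega>))"
        by (rule integrable_const_bound[of _ A]) (auto intro: A)
      then have "(\<integral>\<omega>. \<bar>h (W v \<omega>)\<bar> \<partial>M) \<le> A"
        by (intro integral_le_const) (auto intro: A)
      then show ?thesis
        using integral_abs_bound[of M "\<lambda>\<omega>. h (W v \<omega>)"] Phi(2)[OF that] by simp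
    qed
    have step: "(\<integral>\<omega>. F (Y \<omega>) * h (W (a i (Y \<omega>)) \<omega>) \<partial>M) = (\<integral>\<omega>. F (Y \<omega>) * \<Phi> (a i (Y \<omega>)) \<partial>M)" for i
    proof -
      have ei: "integrable M (\<lambda>\<omega>. F (Y \<omega>) * e i v (Y \<omega>))" for v
        by (rule Bochner_Integration.integrable_bound[OF Fi]) (auto simp: e_def)
      have hi: "integrable M (\<lambda>\<omega>. h (W v \<omega>))" if "v \<in> orthant" for v
      proof -
        have [measurable]: "W v \<in> borel_measurable M" by (rule Wm[OF that])
        show ?thesis by (rule integrable_const_bound[of _ A]) (auto intro: A)
      qed
      \<comment> \<open>\<open>F\<close> times an indicator of the value of \<open>a i\<close> is
        again a function of \<open>Y\<close>, hence an admissible \<open>G\<close>; on each piece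
        the time is the deterministic \<open>v\<close> and the expectation factorises.\<close>
      have ind: "indep_var borel (\<lambda>\<omega>. F (Y \<omega>) * e i v (Y \<omega>)) borel (\<lambda>\<omega>. h (W v \<omega>))" if "v \<in> orthant" for v
        using that by (rule indep) simp
      have "(\<integral>\<omega>. F (Y \<omega>) * h (W (a i (Y \<omega>)) \<omega>) \<partial>M) =
          (\<integral>\<omega>. (\<Sum>v\<in>range (a i). (F (Y \<omega>) * e i v (Y \<omega>)) * h (W v \<omega>)) \<partial>M)"
        by (subst split[of "\<lambda>v. h (W v _)"]) (simp add: sum_distrib_left mult.assoc)
      also have "\<dots> = (\<Sum>v\<in>range (a i). (\<integral>\<omega>. (F (Y \<omega>) * e i v (Y \<omega>)) * h (W v \<omega>) \<partial>M))"
        using ao by (intro Bochner_Integration.integral_sum indep_var_integrable[OF ind ei hi]) auto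
      also have "\<dots> = (\<Sum>v\<in>range (a i). (\<integral>\<omega>. (F (Y \<omega>) * e i v (Y \<omega>)) * \<Phi> v \<partial>M))"
        using ao by (intro sum.cong refl)
          (auto simp: indep_var_lebesgue_integral[OF ind ei hi] Phi(2))
      also have "\<dots> = (\<integral>\<omega>. (\<Sum>v\<in>range (a i). (F (Y \<omega>) * e i v (Y \<omega>)) * \<Phi> v) \<partial>M)"
        by (intro Bochner_Integration.integral_sum[symmetric] integrable_mult_left ei)
      also have "\<dots> = (\<integral>\<omega>. F (Y \<omega>) * \<Phi> (a i (Y \<omega>)) \<partial>M)"
        by (subst split[of "\<lambda>v. \<Phi> v"]) (simp add: sum_distrib_left mult.assoc)
      finally show ?thesis .
    qed
    have [measurable]: "(\<lambda>\<omega>. W (Y \<omega>) \<omega>) \<in> borel_measurable M" by (rule m)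
    have Fi': "integrable M (\<lambda>\<omega>. \<bar>F (Y \<omega>)\<bar> * A)" using Fi by simp
    have "(\<lambda>i. \<integral>\<omega>. F (Y \<omega>) * h (W (a i (Y \<omega>)) \<omega>) \<partial>M) \<longlonglongrightarrow> (\<integral>\<omega>. F (Y \<omega>) * h (W (Y \<omega>) \<omega>) \<partial>M)"
    proof (rule integral_dominated_convergence[OF _ _ Fi'])
      show "AE \<omega> in M. (\<lambda>i. F (Y \<omega>) * h (W (a i (Y \<omega>)) \<omega>)) \<longlonglongrightarrow> F (Y \<omega>) * h (W (Y \<omega>) \<omega>)"
        by (intro AE_I2 tendsto_mult_left continuous_on_tendsto_compose[OF h] Wlim) auto
      show "AE \<omega> in M. norm (F (Y \<omega>) * h (W (a i (Y \<omega>)) \<omega>)) \<le> \<bar>F (Y \<omega>)\<bar> * A" for i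
        by (auto simp: abs_mult intro!: mult_left_mono A)
    qed auto
    moreover have "(\<lambda>i. \<integral>\<omega>. F (Y \<omega>) * \<Phi> (a i (Y \<omega>)) \<partial>M) \<longlonglongrightarrow> (\<integral>\<omega>. F (Y \<omega>) * \<Phi> (Y \<omega>) \<partial>M)"
    proof (rule integral_dominated_convergence[OF _ _ Fi'])
      show "AE \<omega> in M. (\<lambda>i. F (Y \<omega>) * \<Phi> (a i (Y \<omega>))) \<longlonglongrightarrow> F (Y \<omega>) * \<Phi> (Y \<omega>)"
        by (intro AE_I2 tendsto_mult_left continuous_on_tendsto_compose[OF Phi(1)] alim) auto
      show "AE \<omega> in M. norm (F (Y \<omega>) * \<Phi> (a i (Y \<omega>))) \<le> \<bar>F (Y \<omega>)\<bar> * A" for i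
        by (auto simp: abs_mult intro!: mult_left_mono Phi_le ao)
    qed auto
    ultimately show ?thesis unfolding step by (rule LIMSEQ_unique)
  qed
qed

text \<open>The starting point enters only as a translation, so differentiation in \<open>x\<close>
  falls on \<open>g\<close> alone. Applied to \<open>f\<close> and then to its first partials, this
  brings the Laplacian of \<open>btbs_V\<close> inside the expectation.\<close>

lemma partial_integral_shift:
  fixes g :: "real ^ 'd \<Rightarrow> real" and R :: "'w \<Rightarrow> real ^ 'd" and Q :: "'w \<Rightarrow> real"
  assumes Q: "integrable M Q" and R [measurable]: "R \<in> borel_measurable M"
    and ex: "\<And>y. partial_exists k g y"
    and cont: "continuous_on UNIV g" "continuous_on UNIV (partial k g)"
    and A: "\<And>y. \<bar>g y\<bar> \<le> A" and C: "\<And>y. \<bar>partial k g y\<bar> \<le> C"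
  shows "partial_exists k (\<lambda>x. \<integral>\<omega>. Q \<omega> * g (x + R \<omega>) \<partial>M) x"
    and "partial k (\<lambda>x. \<integral>\<omega>. Q \<omega> * g (x + R \<omega>) \<partial>M) x = (\<integral>\<omega>. Q \<omega> * partial k g (x + R \<omega>) \<partial>M)"
proof -
  have [measurable]: "g \<in> borel_measurable borel" "partial k g \<in> borel_measurable borel"
    "Q \<in> borel_measurable M"
    using cont Q by (auto intro: borel_measurable_continuous_onI)
  have "((\<lambda>h. \<integral>\<omega>. Q \<omega> * g (x + h *\<^sub>R axis k 1 + R \<omega>) \<partial>M) has_real_derivative
      (\<integral>\<omega>. Q \<omega> * partial k g (x + 0 *\<^sub>R axis k 1 + R \<omega>) \<partial>M)) (at 0)"
  proof (rule has_real_derivative_integral[where d=1 and w="\<lambda>\<omega>. \<bar>Q \<omega>\<bar> * C"])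
    fix h :: real
    show "integrable M (\<lambda>\<omega>. Q \<omega> * g (x + h *\<^sub>R axis k 1 + R \<omega>))"
      by (rule Bochner_Integration.integrable_bound[where f="\<lambda>\<omega>. \<bar>Q \<omega>\<bar> * A"])
        (use Q in \<open>auto simp: abs_mult intro!: AE_I2 mult_left_mono order_trans[OF A abs_ge_self]\<close>)
    fix \<omega>
    have "((\<lambda>h. Q \<omega> * g ((x + R \<omega>) + h *\<^sub>R axis k 1)) has_real_derivative
        Q \<omega> * partial k g ((x + R \<omega>) + h *\<^sub>R axis k 1)) (at h)"
      by (rule DERIV_cmult) (rule partial_has_real_derivative[OF ex])
    then show "((\<lambda>h. Q \<omega> * g (x + h *\<^sub>R axis k 1 + R \<omega>)) has_real_derivative
        Q \<omega> * partial k g (x + h *\<^sub>R axis k 1 + R \<omega>)) (at h)"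
      by (simp add: add_ac)
    show "\<bar>Q \<omega> * partial k g (x + h *\<^sub>R axis k 1 + R \<omega>)\<bar> \<le> \<bar>Q \<omega>\<bar> * C"
      unfolding abs_mult by (rule mult_left_mono[OF C]) simp
  qed (use Q in auto)
  from partialI[OF this]
  show "partial_exists k (\<lambda>x. \<integral>\<omega>. Q \<omega> * g (x + R \<omega>) \<partial>M) x"
    and "partial k (\<lambda>x. \<integral>\<omega>. Q \<omega> * g (x + R \<omega>) \<partial>M) x = (\<integral>\<omega>. Q \<omega> * partial k g (x + R \<omega>) \<partial>M)"
    by simp_all
qed

section \<open>Laws of the sheet, of the Brownian times, and of their composition\<close>

definition abs_time :: "('n \<Rightarrow> real \<Rightarrow> 'w \<Rightarrow> real) \<Rightarrow> real ^ 'n \<Rightarrow> 'w \<Rightarrow> real ^ 'n" where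
  "abs_time B t \<omega> = (\<chi> i. \<bar>B i (t $ i) \<omega>\<bar>)"

definition other_times :: "('n \<Rightarrow> real \<Rightarrow> 'w \<Rightarrow> real) \<Rightarrow> 'n \<Rightarrow> real ^ 'n \<Rightarrow> 'w \<Rightarrow> real" where
  "other_times B j t \<omega> = (\<Prod>i\<in>UNIV - {j}. \<bar>B i (t $ i) \<omega>\<bar>)"

lemma abs_time_orthant: "abs_time B t \<omega> \<in> orthant"
  by (simp add: abs_time_def orthant_def)

lemma btbs_eq: "btbs W B x t \<omega> = x + W (abs_time B t \<omega>) \<omega>"
  by (simp add: btbs_def abs_time_def)

context
  fixes M :: "'w measure"
    and W :: "real ^ 'n \<Rightarrow> 'w \<Rightarrow> real ^ 'd"
    and B :: "'n \<Rightarrow> real \<Rightarrow> 'w \<Rightarrow> real"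
  assumes procs: "btbs_processes M W B"
begin

interpretation prob_space M
  using procs by (simp add: btbs_processes_def)

lemma sheet: "real_brownian_sheet M (\<lambda>t \<omega>. W t \<omega> $ k)"
  using procs by (simp add: btbs_processes_def brownian_sheet_def)

lemma motion: "standard_brownian_motion M (B i)"
  using procs by (simp add: btbs_processes_def)

lemma sheet_measurable: "s \<in> orthant \<Longrightarrow> W s \<in> borel_measurable M"
  using borel_measurable_vec_lambda[of "\<lambda>\<omega> k. W s \<omega> $ k" M] sheet by (simp add: real_brownian_sheet_def)

lemma sheet_continuous:
  assumes "\<omega> \<in> space M"
  shows "continuous_on orthant (\<lambda>t. W t \<omega>)"
proof -
  have "continuous_on orthant (\<lambda>t. \<chi> k. W t \<omega> $ k)"
    using sheet assms by (intro continuous_on_vec_lambda) (simp add: real_brownian_sheet_def)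
  then show ?thesis by simp
qed

lemma sheet_boundary: "\<omega> \<in> space M \<Longrightarrow> t \<in> orthant_boundary \<Longrightarrow> W t \<omega> = 0"
  using sheet by (simp add: real_brownian_sheet_def vec_eq_iff)

text \<open>The definition of the sheet provides some \<open>\<sigma>\<close> for each linear
  combination. A one-point combination together with the covariance at equal arguments identifies
  \<open>\<sigma>\<^sup>2\<close> as the product of the coordinates.\<close>

lemma distr_sheet:
  assumes s: "s \<in> orthant"
  shows "distr M borel (\<lambda>\<omega>. W s \<omega> $ k) = centred_gaussian (sqrt (\<Prod>i\<in>UNIV. s $ i))"
proof -
  have [measurable]: "(\<lambda>\<omega>. W s \<omega> $ k) \<in> borel_measurable M"
    using sheet[of k] s by (simp add: real_brownian_sheet_def)
  have "\<forall>T a. finite T \<and> T \<subseteq> orthant \<longrightarrow>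
      (\<exists>\<sigma>\<ge>0. distr M borel (\<lambda>\<omega>. \<Sum>t\<in>T. a t * W t \<omega> $ k) = centred_gaussian \<sigma>)"
    using sheet[of k] unfolding real_brownian_sheet_def by blast
  from this[rule_format, of "{s}" "\<lambda>_. 1"] s
  obtain \<sigma> where \<sigma>: "\<sigma> \<ge> 0" "distr M borel (\<lambda>\<omega>. W s \<omega> $ k) = centred_gaussian \<sigma>" by auto
  have "\<sigma>\<^sup>2 = (\<integral>y. y\<^sup>2 \<partial>distr M borel (\<lambda>\<omega>. W s \<omega> $ k))"
    using \<sigma> by (simp add: integral_centred_gaussian_square)
  also have "\<dots> = (\<integral>\<omega>. W s \<omega> $ k * W s \<omega> $ k \<partial>M)"
    by (subst integral_distr) (auto simp: power2_eq_square)
  also have "\<dots> = (\<Prod>i\<in>UNIV. min (s $ i) (s $ i))"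
    using sheet[of k] s unfolding real_brownian_sheet_def by blast
  finally have "\<sigma> = sqrt (\<Prod>i\<in>UNIV. s $ i)"
    using \<sigma>(1) by (simp add: real_sqrt_unique)
  with \<sigma>(2) show ?thesis by simp
qed

text \<open>Independence of the coordinates makes the joint law a product of equal centred
  Gaussians, which is the image of \<open>gaussian_coords\<close> under multiplication by the common
  standard deviation.\<close>

lemma expectation_sheet:
  fixes h :: "real ^ 'd \<Rightarrow> real"
  assumes s: "s \<in> orthant" and h: "continuous_on UNIV h"
  shows "(\<integral>\<omega>. h (x + W s \<omega>) \<partial>M) = gauss_mean h x (\<Prod>i\<in>UNIV. s $ i)"
proof -
  define \<sigma> where "\<sigma> = sqrt (\<Prod>i\<in>UNIV. s $ i)"
  have \<sigma>0: "\<sigma> \<ge> 0" using s by (auto simp: \<sigma>_def orthant_def intro!: prod_nonneg)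
  have hm [measurable]: "h \<in> borel_measurable borel"
    using h by (rule borel_measurable_continuous_onI)
  have Wm [measurable]: "(\<lambda>\<omega>. W s \<omega> $ k) \<in> borel_measurable M" for k
    using sheet[of k] s by (simp add: real_brownian_sheet_def)
  have "indep_sets (\<lambda>k. process_sigma M orthant (\<lambda>t \<omega>. W t \<omega> $ k)) UNIV"
    using procs by (simp add: btbs_processes_def brownian_sheet_def)
  then have "indep_vars (\<lambda>_. borel) (\<lambda>k \<omega>. W s \<omega> $ k) UNIV"
    unfolding process_sigma_def
    by (rule indep_vars_of_algebras) (auto intro!: process_measurable s)
  then have "distr M (Pi\<^sub>M UNIV (\<lambda>_. borel)) (\<lambda>\<omega>. \<lambda>k\<in>UNIV. W s \<omega> $ k) = Pi\<^sub>M UNIV (\<lambda>k. distr M borel (\<lambda>\<omega>. W s \<omega> $ k))"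
    by (subst (asm) indep_vars_iff_distr_eq_PiM) auto
  also have "\<dots> = Pi\<^sub>M UNIV (\<lambda>k::'d. distr std_gaussian borel (\<lambda>z. \<sigma> * z))"
    by (simp add: distr_sheet[OF s] \<sigma>_def[symmetric] centred_gaussian_eq_distr[OF \<sigma>0])
  also have "\<dots> = distr gaussian_coords (Pi\<^sub>M UNIV (\<lambda>_::'d. borel)) (compose UNIV (\<lambda>z. \<sigma> * z))"
  proof -
    \<comment> \<open>\<open>borel\<close> and \<open>std_gaussian\<close> have the same sets; with
      the latter as target the rule for coordinatewise images of a product measure applies.\<close>
    have "distr gaussian_coords (Pi\<^sub>M UNIV (\<lambda>_::'d. borel)) (compose UNIV (\<lambda>z. \<sigma> * z)) =
        distr gaussian_coords gaussian_coords (compose UNIV (\<lambda>z. \<sigma> * z) :: ('d \<Rightarrow> real) \<Rightarrow> _)"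
      by (rule distr_cong) (auto intro!: sets_PiM_cong)
    also have "\<dots> = Pi\<^sub>M UNIV (\<lambda>_::'d. distr std_gaussian std_gaussian (\<lambda>z. \<sigma> * z))"
      by (rule distr_PiM_finite_prob_space') (auto intro: prob_space_std_gaussian)
    also have "distr std_gaussian std_gaussian (\<lambda>z. \<sigma> * z) = distr std_gaussian borel (\<lambda>z. \<sigma> * z)"
      by (rule distr_cong) auto
    finally show ?thesis ..
  qed
  finally have law: "distr M (Pi\<^sub>M UNIV (\<lambda>_. borel)) (\<lambda>\<omega>. \<lambda>k\<in>UNIV. W s \<omega> $ k) =
      distr gaussian_coords (Pi\<^sub>M UNIV (\<lambda>_::'d. borel)) (compose UNIV (\<lambda>z. \<sigma> * z))" .
  have vm: "(\<lambda>\<zeta>. h (x + vec_lambda \<zeta>)) \<in> borel_measurable (Pi\<^sub>M UNIV (\<lambda>_::'d. borel))"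
  proof -
    have [measurable]: "vec_lambda \<in> borel_measurable (Pi\<^sub>M UNIV (\<lambda>_::'d. borel :: real measure))"
      using borel_measurable_vec_lambda[of "\<lambda>\<zeta>. \<zeta>" "Pi\<^sub>M UNIV (\<lambda>_::'d. borel :: real measure)"] by simp
    show ?thesis by measurable
  qed
  have scale: "vec_lambda (compose UNIV (\<lambda>z. \<sigma> * z) \<zeta>) = \<sigma> *\<^sub>R vec_lambda \<zeta>" for \<zeta> :: "'d \<Rightarrow> real"
    by (simp add: vec_eq_iff compose_def)
  have "(\<integral>\<omega>. h (x + W s \<omega>) \<partial>M) =
      (\<integral>\<zeta>. h (x + vec_lambda \<zeta>) \<partial>distr M (Pi\<^sub>M UNIV (\<lambda>_. borel)) (\<lambda>\<omega>. \<lambda>k\<in>UNIV. W s \<omega> $ k))"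
  proof -
    have "(\<lambda>\<omega>. \<lambda>k\<in>UNIV. W s \<omega> $ k) \<in> measurable M (Pi\<^sub>M UNIV (\<lambda>_. borel))"
      by (rule measurable_restrict) (rule Wm)
    from integral_distr[OF this vm] show ?thesis by (simp add: restrict_def)
  qed
  also have "\<dots> = (\<integral>\<zeta>. h (x + vec_lambda (compose UNIV (\<lambda>z. \<sigma> * z) \<zeta>)) \<partial>gaussian_coords)"
    unfolding law
  proof (rule integral_distr[OF _ vm])
    show "compose UNIV (\<lambda>z. \<sigma> * z) \<in> measurable gaussian_coords (Pi\<^sub>M UNIV (\<lambda>_::'d. borel))"
      unfolding compose_def[abs_def] by (rule measurable_restrict) measurable
  qed
  finally show ?thesis unfolding scale by (simp add: gauss_mean_def \<sigma>_def)
qed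

lemma motion_measurable: "t \<ge> 0 \<Longrightarrow> B i t \<in> borel_measurable M"
  using motion by (simp add: standard_brownian_motion_def)

lemma motion_0: "\<omega> \<in> space M \<Longrightarrow> B i 0 \<omega> = 0"
  using motion by (simp add: standard_brownian_motion_def)

lemma distr_motion:
  assumes "t \<ge> 0"
  shows "distr M borel (B i t) = centred_gaussian (sqrt t)"
proof (cases "t = 0")
  case True
  have "distr M borel (B i 0) = distr M borel (\<lambda>_. 0)"
    by (rule distr_cong) (auto simp: motion_0)
  with True show ?thesis
    using distr_const[of "0::real" borel] by (simp add: centred_gaussian_def)
next
  case False
  with assms have "distr M borel (\<lambda>\<omega>. B i t \<omega> - B i 0 \<omega>) = centred_gaussian (sqrt (t - 0))"
    using motion[of i] unfolding standard_brownian_motion_def by (metis order.refl order_le_less)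
  moreover have "distr M borel (\<lambda>\<omega>. B i t \<omega> - B i 0 \<omega>) = distr M borel (B i t)"
    by (rule distr_cong) (auto simp: motion_0)
  ultimately show ?thesis by simp
qed

lemma
  assumes t: "t \<ge> 0"
  shows integrable_abs_motion: "integrable M (\<lambda>\<omega>. \<bar>B i t \<omega>\<bar>)"
    and expectation_abs_motion: "(\<integral>\<omega>. \<bar>B i t \<omega>\<bar> \<partial>M) = sqrt (2 / pi) * t powr (1/2)"
proof -
  have [measurable]: "B i t \<in> borel_measurable M" by (rule motion_measurable[OF t])
  have "integrable (distr std_gaussian borel (\<lambda>z. sqrt t * z)) (\<lambda>y. \<bar>y\<bar>)"
    by (subst integrable_distr_eq) (auto simp: abs_mult integrable_std_gaussian_abs)
  then have "integrable (distr M borel (B i t)) (\<lambda>y. \<bar>y\<bar>)"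
    using t by (simp add: distr_motion centred_gaussian_eq_distr)
  then show "integrable M (\<lambda>\<omega>. \<bar>B i t \<omega>\<bar>)"
    by (subst (asm) integrable_distr_eq) auto
  have "(\<integral>\<omega>. \<bar>B i t \<omega>\<bar> \<partial>M) = (\<integral>y. \<bar>y\<bar> \<partial>distr M borel (B i t))"
    by (subst integral_distr) auto
  also have "\<dots> = sqrt (2 / pi) * t powr (1/2)"
    using t by (simp add: distr_motion integral_centred_gaussian abs_mult integral_std_gaussian_abs powr_half_sqrt)
  finally show "(\<integral>\<omega>. \<bar>B i t \<omega>\<bar> \<partial>M) = sqrt (2 / pi) * t powr (1/2)" .
qed

lemma indep_motions:
  assumes "t \<in> orthant"
  shows "indep_vars (\<lambda>_. borel) (\<lambda>i. B i (t $ i)) UNIV"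
proof (rule indep_vars_of_algebras)
  show "indep_sets (\<lambda>i. sets (process_algebra M {0..} (B i))) UNIV"
    using procs by (simp add: btbs_processes_def process_sigma_def)
qed (use assms in \<open>auto intro!: process_measurable simp: orthant_def\<close>)

lemma
  assumes t: "t \<in> orthant"
  shows integrable_other_times: "integrable M (other_times B j t)"
    and expectation_other_times: "(\<integral>\<omega>. other_times B j t \<omega> \<partial>M) =
      (\<Prod>i\<in>UNIV - {j}. sqrt (2 / pi) * (t $ i) powr (1/2))"
proof -
  have "indep_vars (\<lambda>_. borel) (\<lambda>i \<omega>. \<bar>B i (t $ i) \<omega>\<bar>) (UNIV - {j})"
    using indep_vars_subset[OF indep_vars_compose2[OF indep_motions[OF t], of "\<lambda>_ y. \<bar>y\<bar>" "\<lambda>_. borel"]]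
    by simp
  note * = this integrable_abs_motion
  show "integrable M (other_times B j t)"
    unfolding other_times_def[abs_def] using t by (intro indep_vars_integrable *) (auto simp: orthant_def)
  show "(\<integral>\<omega>. other_times B j t \<omega> \<partial>M) = (\<Prod>i\<in>UNIV - {j}. sqrt (2 / pi) * (t $ i) powr (1/2))"
    unfolding other_times_def using t
    by (subst indep_vars_lebesgue_integral) (auto simp: orthant_def expectation_abs_motion intro!: *)
qed

text \<open>\<open>other_times B j t\<close> ignores the \<open>j\<close>-th coordinate of
  \<open>t\<close>, so its law is the same for all \<open>s\<close>; it is independent of
  \<open>B j s\<close>, and all dependence on \<open>s\<close> is concentrated in the factor
  \<open>sqrt s\<close>.\<close>

lemma expectation_other_times_motion:
  fixes G :: "real \<times> real \<Rightarrow> real"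
  assumes t: "t \<in> orthant" and s: "s \<ge> 0" and G [measurable]: "G \<in> borel_measurable (borel \<Otimes>\<^sub>M borel)"
  shows "(\<integral>\<omega>. G (other_times B j t \<omega>, B j s \<omega>) \<partial>M) =
    (\<integral>x. G (fst x, sqrt s * snd x) \<partial>(distr M borel (other_times B j t) \<Otimes>\<^sub>M std_gaussian))"
proof -
  let ?\<nu> = "distr M borel (other_times B j t)"
  \<comment> \<open>Replacing the \<open>j\<close>-th time by \<open>s\<close> lets one use of
    \<open>indep_motions\<close> cover both variables. \<open>?X\<close> keeps the sign of the
    \<open>j\<close>-th motion and takes absolute values of the others.\<close>
  let ?t = "\<chi> i. if i = j then s else t $ i"
  let ?X = "\<lambda>i \<omega>. if i = j then B i (?t $ i) \<omega> else \<bar>B i (?t $ i) \<omega>\<bar>"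
  have Bm [measurable]: "B j s \<in> borel_measurable M" by (rule motion_measurable[OF s])
  have Qm [measurable]: "other_times B j t \<in> borel_measurable M"
    using integrable_other_times[OF t] by auto
  have "?t \<in> orthant" using t s by (simp add: orthant_def)
  from indep_vars_compose2[OF indep_motions[OF this], of "\<lambda>i y. if i = j then y else \<bar>y\<bar>" "\<lambda>_. borel"]
  have "indep_vars (\<lambda>_. borel) ?X UNIV" by simp
  moreover have "insert j (UNIV - {j}) = UNIV" by auto
  ultimately have "indep_var borel (?X j) borel (\<lambda>\<omega>. \<Prod>i\<in>UNIV - {j}. ?X i \<omega>)"
    by (intro indep_vars_prod) auto
  moreover have "?X j = B j s" by auto
  moreover have "(\<lambda>\<omega>. \<Prod>i\<in>UNIV - {j}. ?X i \<omega>) = other_times B j t"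
    by (auto simp: other_times_def fun_eq_iff intro!: prod.cong)
  ultimately have "indep_var borel (B j s) borel (other_times B j t)" by simp
  then have joint: "distr M borel (B j s) \<Otimes>\<^sub>M ?\<nu> = distr M (borel \<Otimes>\<^sub>M borel) (\<lambda>\<omega>. (B j s \<omega>, other_times B j t \<omega>))"
    by (simp add: indep_var_distribution_eq)
  interpret N: prob_space "distr M borel (other_times B j t)" by (rule prob_space_distr) simp
  interpret S: prob_space "distr M borel (B j s)" by (rule prob_space_distr) simp
  have sp: "sets (borel \<Otimes>\<^sub>M borel) = sets (?\<nu> \<Otimes>\<^sub>M distr M borel (B j s))"
    by (auto intro!: sets_pair_measure_cong)
  have "(\<integral>\<omega>. G (other_times B j t \<omega>, B j s \<omega>) \<partial>M) =
      (\<integral>x. (case x of (y, q) \<Rightarrow> G (q, y)) \<partial>distr M (borel \<Otimes>\<^sub>M borel) (\<lambda>\<omega>. (B j s \<omega>, other_times B j t \<omega>)))"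
    by (subst integral_distr) auto
  also have "\<dots> = (\<integral>(y, q). G (q, y) \<partial>(distr M borel (B j s) \<Otimes>\<^sub>M ?\<nu>))"
    by (simp add: joint)
  also have "\<dots> = integral\<^sup>L (?\<nu> \<Otimes>\<^sub>M distr M borel (B j s)) G"
  proof -
    interpret NS: pair_sigma_finite ?\<nu> "distr M borel (B j s)" ..
    show ?thesis
      by (rule NS.integral_product_swap) (use G measurable_cong_sets[OF sp refl] in blast)
  qed
  also have "\<dots> = integral\<^sup>L (distr (?\<nu> \<Otimes>\<^sub>M std_gaussian) (?\<nu> \<Otimes>\<^sub>M borel) (\<lambda>x. (fst x, sqrt s * snd x))) G"
    using s by (simp add: distr_motion pair_centred_gaussian_distr)
  also have "\<dots> = (\<integral>x. G (fst x, sqrt s * snd x) \<partial>(?\<nu> \<Otimes>\<^sub>M std_gaussian))"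
  proof (rule integral_distr)
    have "sets (?\<nu> \<Otimes>\<^sub>M borel) = sets (borel \<Otimes>\<^sub>M borel)" by (rule sets_pair_measure_cong) auto
    then show "G \<in> borel_measurable (?\<nu> \<Otimes>\<^sub>M borel)"
      using G measurable_cong_sets[OF _ refl] by blast
  qed simp
  finally show ?thesis .
qed

lemma abs_time_measurable:
  assumes "t \<in> orthant"
  shows "abs_time B t \<in> borel_measurable M"
  unfolding abs_time_def[abs_def] using assms
  by (intro borel_measurable_vec_lambda borel_measurable_abs motion_measurable) (simp add: orthant_def)

lemma sheet_abs_time_measurable:
  assumes "t \<in> orthant"
  shows "(\<lambda>\<omega>. W (abs_time B t \<omega>) \<omega>) \<in> borel_measurable M"
  by (rule borel_measurable_random_time[OF sheet_measurable sheet_continuous abs_time_measurable[OF assms] abs_time_orthant])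

text \<open>Conditioning on the Brownian times, with a weight that is a function of them:
  \<open>F = 1\<close> serves \<open>btbs_u\<close>, and the product over the indices other than
  \<open>j\<close> serves the Laplacian of \<open>btbs_V\<close>.\<close>

lemma expectation_btbs:
  fixes h :: "real ^ 'd \<Rightarrow> real" and F :: "real ^ 'n \<Rightarrow> real"
  assumes t: "t \<in> orthant" and F [measurable]: "F \<in> borel_measurable borel"
    and Fi: "integrable M (\<lambda>\<omega>. F (abs_time B t \<omega>))"
    and h: "continuous_on UNIV h" and A: "\<And>y. \<bar>h y\<bar> \<le> A"
  shows "(\<integral>\<omega>. F (abs_time B t \<omega>) * h (btbs W B x t \<omega>) \<partial>M) =
    (\<integral>\<omega>. F (abs_time B t \<omega>) * gauss_mean h x (\<Prod>i\<in>UNIV. abs_time B t \<omega> $ i) \<partial>M)"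
  unfolding btbs_eq
proof (rule integral_random_time[where A=A and h="\<lambda>y. h (x + y)" and \<Phi>="\<lambda>v. gauss_mean h x (\<Prod>i\<in>UNIV. v $ i)",
      OF sheet_measurable sheet_continuous abs_time_measurable[OF t] abs_time_orthant _ F Fi])
  have hm [measurable]: "h \<in> borel_measurable borel"
    using h by (rule borel_measurable_continuous_onI)
  show "continuous_on UNIV (\<lambda>y. h (x + y))"
    by (intro continuous_on_compose2[OF h] continuous_intros) auto
  show "continuous_on UNIV (\<lambda>v. gauss_mean h x (\<Prod>i\<in>UNIV. v $ i))"
    by (intro continuous_on_compose2[OF continuous_on_gauss_mean[OF h A]] continuous_intros) auto
  show "(\<integral>\<omega>. h (x + W v \<omega>) \<partial>M) = gauss_mean h x (\<Prod>i\<in>UNIV. v $ i)" if "v \<in> orthant" for v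
    by (rule expectation_sheet[OF that h])
  fix v :: "real ^ 'n" and G :: "real ^ 'n \<Rightarrow> real"
  assume v: "v \<in> orthant" and G: "G \<in> borel_measurable borel"
  let ?NB = "process_algebra M (UNIV \<times> {0..}) (\<lambda>(i, t). B i t)" and ?NW = "process_algebra M orthant W"
  have "indep_set (sets ?NW) (sets ?NB)"
    using procs unfolding btbs_processes_def process_sigma_def by blast
  then have "indep_set (sets ?NB) (sets ?NW)"
    unfolding indep_sets2_eq by (metis Int_commute mult.commute)
  then show "indep_var borel (\<lambda>\<omega>. G (abs_time B t \<omega>)) borel (\<lambda>\<omega>. h (x + W v \<omega>))"
  proof (rule indep_var_of_algebras)
    have "B i (t $ i) \<in> borel_measurable ?NB" for i
      using process_measurable[of "(i, t $ i)" "UNIV \<times> {0..}" "\<lambda>(i, t). B i t" M] t by (simp add: orthant_def)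
    then have "abs_time B t \<in> borel_measurable ?NB"
      unfolding abs_time_def[abs_def] by (intro borel_measurable_vec_lambda borel_measurable_abs)
    then show "(\<lambda>\<omega>. G (abs_time B t \<omega>)) \<in> borel_measurable ?NB"
      using G by (rule measurable_compose)
    have "W v \<in> borel_measurable ?NW" using v by (rule process_measurable)
    then show "(\<lambda>\<omega>. h (x + W v \<omega>)) \<in> borel_measurable ?NW" by measurable
  qed simp_all
qed (use A in auto)

lemma btbs_boundary:
  assumes "t \<in> orthant" "t $ i = 0" "\<omega> \<in> space M"
  shows "btbs W B x t \<omega> = x"
proof -
  have "abs_time B t \<omega> \<in> orthant_boundary"
    using abs_time_orthant assms motion_0[of \<omega> i] by (auto simp: orthant_boundary_def abs_time_def intro!: exI[of _ i])
  then show ?thesis using sheet_boundary[OF assms(3)] by (simp add: btbs_eq)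
qed

end

section \<open>The fractional boundary value problem\<close>

theorem theorem1p1:
  fixes M :: "'w measure"
    and W :: "real ^ 'n \<Rightarrow> 'w \<Rightarrow> real ^ 'd"
    and B :: "'n \<Rightarrow> real \<Rightarrow> 'w \<Rightarrow> real"
    and f :: "real ^ 'd \<Rightarrow> real"
    and \<alpha> :: real
  assumes procs: "btbs_processes M W B"
    and f_meas: "f \<in> borel_measurable borel"
    and f_bdd: "bounded (range f)"
    and alpha: "0 < \<alpha>" "\<alpha> \<le> 1"
    and f_C2: "second_partials_exist f"
    and f2_bdd: "\<And>k l. bounded (range (partial k (partial l f)))"
    and f2_hoelder: "\<And>k l. hoelder \<alpha> (partial k (partial l f))"
  shows
    "(\<forall>t\<in>orthant. \<forall>x.
        integrable M (\<lambda>\<omega>. f (btbs W B x t \<omega>)) \<and>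
        (\<forall>j. integrable M (\<lambda>\<omega>. (\<Prod>i\<in>UNIV - {j}. \<bar>B i (t $ i) \<omega>\<bar>) * f (btbs W B x t \<omega>)))) \<and>
     (\<forall>j.
        (\<forall>t\<in>open_orthant. \<forall>x.
            caputo_exists (1/2) (\<lambda>s. btbs_u M W B f (vec_upd t j s) x) (t $ j) \<and>
            second_partials_exist (btbs_V M W B f j t) \<and>
            caputo_deriv (1/2) (\<lambda>s. btbs_u M W B f (vec_upd t j s) x) (t $ j)
              = 1 / sqrt 8 * laplacian (btbs_V M W B f j t) x) \<and>
        (\<forall>t\<in>orthant_boundary. \<forall>x. btbs_u M W B f t x = f x) \<and>
        (\<forall>t\<in>orthant. \<forall>x. (\<exists>i\<in>UNIV - {j}. t $ i = 0) \<longrightarrow> btbs_V M W B f j t x = 0) \<and>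
        (\<forall>t\<in>orthant. \<forall>x. t $ j = 0 \<longrightarrow>
            btbs_V M W B f j t x
              = (\<Prod>i\<in>UNIV - {j}. sqrt (2 / pi) * (t $ i) powr (1/2)) * f x)) \<and>
     (CARD('n) = 1 \<longrightarrow>
        (\<forall>j. \<forall>t\<in>orthant. \<forall>x. btbs_u M W B f t x = btbs_V M W B f j t x) \<and>
        (\<forall>t>0. \<forall>x.
            caputo_exists (1/2) (\<lambda>s. btbs_u M W B f (vec s) x) t \<and>
            second_partials_exist (btbs_u M W B f (vec t)) \<and>
            caputo_deriv (1/2) (\<lambda>s. btbs_u M W B f (vec s) x) t
              = 1 / sqrt 8 * laplacian (btbs_u M W B f (vec t)) x) \<and>
        (\<forall>x. btbs_u M W B f (vec 0) x = f x))"
proof -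
  interpret prob_space M using procs by (simp add: btbs_processes_def)
  obtain A where A: "\<And>y. \<bar>f y\<bar> \<le> A"
    using f_bdd by (auto simp: bounded_iff)
  obtain C' where C': "\<And>k l y. \<bar>partial k (partial l f) y\<bar> \<le> C' k l"
    using f2_bdd by (auto simp: bounded_iff) metis
  \<comment> \<open>One bound for all pairs of indices; summing works because each
    \<open>C' k l\<close> is nonnegative.\<close>
  define C where "C = (\<Sum>k\<in>UNIV. \<Sum>l\<in>UNIV. C' k l)"
  have C: "\<bar>partial k (partial l f) y\<bar> \<le> C" for k l y
  proof -
    have C0: "0 \<le> C' k l" for k l using order_trans[OF abs_ge_zero C'] .
    have "C' k l \<le> (\<Sum>l\<in>UNIV. C' k l)" by (rule member_le_sum) (auto intro: C0)
    also have "\<dots> \<le> C" unfolding C_def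
      by (rule member_le_sum[of k UNIV "\<lambda>k. \<Sum>l\<in>UNIV. C' k l"]) (auto intro!: sum_nonneg C0)
    finally show ?thesis using C'[of k l y] by simp
  qed
  have ex1: "partial_exists k f y" and ex2: "partial_exists k (partial l f) y" for k l y
    using f_C2 by (auto simp: second_partials_exist_def)
  \<comment> \<open>The bound on first partials obtained by interpolation; continuity of
    \<open>f\<close> is then deduced from it.\<close>
  define D where "D = 2 * A + C"
  have D: "\<bar>partial k f y\<bar> \<le> D" for k y
    unfolding D_def by (rule bounded_partial[OF ex1 ex2 A C])
  have c0: "continuous_on UNIV f" by (rule continuous_on_bounded_partials[OF ex1 D])
  have c1: "continuous_on UNIV (partial k f)" for k by (rule continuous_on_bounded_partials[OF ex2 C])
  have c2: "continuous_on UNIV (partial k (partial l f))" for k l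
    by (rule hoelder_continuous_on[OF f2_hoelder alpha(1)])
  have cL: "continuous_on UNIV (laplacian f)"
    unfolding laplacian_def[abs_def] by (intro continuous_intros c2)
  define L where "L = real CARD('d) * C"
  have L: "\<bar>laplacian f y\<bar> \<le> L" for y
    unfolding laplacian_def L_def by (rule order_trans[OF sum_abs]) (rule sum_bounded_above, rule C)
  let ?Q = "other_times B"
  have V: "btbs_V M W B f j t = (\<lambda>x. \<integral>\<omega>. ?Q j t \<omega> * f (x + W (abs_time B t \<omega>) \<omega>) \<partial>M)" for j t
    by (simp add: btbs_V_def[abs_def] other_times_def btbs_eq)
  note Wm [measurable] = sheet_abs_time_measurable[OF procs]
  have Qi: "integrable M (?Q j t)" if "t \<in> orthant" for j t
    by (rule integrable_other_times[OF procs that])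
  have int: "integrable M (\<lambda>\<omega>. f (btbs W B x t \<omega>))" if "t \<in> orthant" for t x
    unfolding btbs_eq
    by (rule integrable_const_bound[of _ A]) (use A f_meas Wm[OF that] in auto)
  have intV: "integrable M (\<lambda>\<omega>. ?Q j t \<omega> * g (x + W (abs_time B t \<omega>) \<omega>))"
    if t: "t \<in> orthant" and g: "continuous_on UNIV g" "\<And>y. \<bar>g y\<bar> \<le> K" for t x j K and g :: "real ^ 'd \<Rightarrow> real"
  proof (rule Bochner_Integration.integrable_bound[where f="\<lambda>\<omega>. \<bar>?Q j t \<omega>\<bar> * K"])
    have [measurable]: "g \<in> borel_measurable borel" "?Q j t \<in> borel_measurable M"
      using g(1) Qi[OF t] by (auto intro: borel_measurable_continuous_onI)
    show "(\<lambda>\<omega>. ?Q j t \<omega> * g (x + W (abs_time B t \<omega>) \<omega>)) \<in> borel_measurable M"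
      using Wm[OF t] by measurable
  qed (use Qi[OF t] in \<open>auto simp: abs_mult intro!: AE_I2 mult_left_mono order_trans[OF g(2) abs_ge_self]\<close>)
  \<comment> \<open>The first partial is recorded as an equality of functions of \<open>x\<close>,
    since it is differentiated again in \<open>V2\<close>.\<close>
  have V1: "partial_exists k (btbs_V M W B f j t) x"
      "partial k (btbs_V M W B f j t) = (\<lambda>x. \<integral>\<omega>. ?Q j t \<omega> * partial k f (x + W (abs_time B t \<omega>) \<omega>) \<partial>M)"
    if t: "t \<in> orthant" for k j t x
    unfolding V using partial_integral_shift[OF Qi[OF t] Wm[OF t] ex1 c0 c1 A D] by (auto simp: fun_eq_iff)
  have V2: "partial_exists k (partial l (btbs_V M W B f j t)) x"
      "partial k (partial l (btbs_V M W B f j t)) x =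
        (\<integral>\<omega>. ?Q j t \<omega> * partial k (partial l f) (x + W (abs_time B t \<omega>) \<omega>) \<partial>M)"
    if t: "t \<in> orthant" for k l j t x
    unfolding V1(2)[OF t] by (rule partial_integral_shift[OF Qi[OF t] Wm[OF t] ex2 c1 c2 D C])+
  have V_ex: "second_partials_exist (btbs_V M W B f j t)" if "t \<in> orthant" for j t
    using V1(1)[OF that] V2(1)[OF that] by (simp add: second_partials_exist_def)
  have V_lap: "laplacian (btbs_V M W B f j t) x = (\<integral>\<omega>. ?Q j t \<omega> * laplacian f (btbs W B x t \<omega>) \<partial>M)"
    if t: "t \<in> orthant" for j t x
    unfolding laplacian_def V2(2)[OF t] btbs_eq sum_distrib_left
    by (rule Bochner_Integration.integral_sum[symmetric]) (rule intV[OF t c2 C])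
  have prodQ: "(\<Prod>i\<in>UNIV. abs_time B t \<omega> $ i) = \<bar>B j (t $ j) \<omega>\<bar> * ?Q j t \<omega>" for t j \<omega>
    by (subst prod.remove[of UNIV j]) (simp_all add: abs_time_def other_times_def)
  have Q0: "?Q j t \<omega> \<ge> 0" for j t \<omega> by (auto simp: other_times_def intro!: prod_nonneg)
  have caputo: "caputo_exists (1/2) (\<lambda>s. btbs_u M W B f (vec_upd t j s) x) (t $ j)"
      "caputo_deriv (1/2) (\<lambda>s. btbs_u M W B f (vec_upd t j s) x) (t $ j)
        = 1 / sqrt 8 * laplacian (btbs_V M W B f j t) x"
    if t: "t \<in> open_orthant" for t j x
  proof -
    have to: "t \<in> orthant" using t by (auto simp: orthant_def open_orthant_def less_imp_le)
    have tj: "t $ j > 0" using t by (simp add: open_orthant_def)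
    let ?\<nu> = "distr M borel (?Q j t)"
    have Qm [measurable]: "?Q j t \<in> borel_measurable M" using Qi[OF to] by auto
    define \<phi> where "\<phi> = gauss_mean f x"
    define \<psi> where "\<psi> = gauss_mean (laplacian f) x"
    have phi: "continuous_on UNIV \<phi>" "\<bar>\<phi> p\<bar> \<le> A" for p
      unfolding \<phi>_def by (rule continuous_on_gauss_mean[OF c0 A], rule gauss_mean_bounded[OF c0 A])
    have psi: "continuous_on UNIV \<psi>" "\<bar>\<psi> p\<bar> \<le> L" for p
      unfolding \<psi>_def by (rule continuous_on_gauss_mean[OF cL L], rule gauss_mean_bounded[OF cL L])
    have [measurable]: "\<phi> \<in> borel_measurable borel" "\<psi> \<in> borel_measurable borel"
      using phi psi by (auto intro: borel_measurable_continuous_onI)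
    have deriv: "(\<phi> has_real_derivative \<psi> p / 2) (at p)" if "p > 0" for p
      unfolding \<phi>_def \<psi>_def by (rule gauss_mean_has_real_derivative[OF f_C2 c0 c1 c2 A D C that])
    have nu: "prob_space ?\<nu>" by (rule prob_space_distr) simp
    \<comment> \<open>The mixture lemma is applied on the real line with the law of
      \<open>?Q j t\<close>. It asks for a weight that is nonnegative on the whole space, hence
      \<open>\<bar>q\<bar>\<close> in place of \<open>q\<close>; by \<open>Q0\<close> the two agree
      on the values of \<open>?Q j t\<close>.\<close>
    have nu_int: "integrable ?\<nu> (\<lambda>q. \<bar>q\<bar>)"
      by (subst integrable_distr_eq) (use Qi[OF to] in auto)
    have u: "btbs_u M W B f (vec_upd t j s) x =
        (\<integral>y. \<phi> (sqrt s * (\<bar>snd y\<bar> * \<bar>fst y\<bar>)) \<partial>(?\<nu> \<Otimes>\<^sub>M std_gaussian))" if s: "s \<ge> 0" for s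
    proof -
      let ?t = "vec_upd t j s"
      have ts: "?t \<in> orthant" using to s by (simp add: orthant_def vec_upd_def)
      \<comment> \<open>Only the \<open>j\<close>-th time moves, so the mixing law is one and the
        same for all \<open>s\<close>.\<close>
      have Qs: "?Q j ?t = ?Q j t"
        by (auto simp: other_times_def fun_eq_iff vec_upd_def intro!: prod.cong)
      have "btbs_u M W B f ?t x = (\<integral>\<omega>. (\<lambda>_. 1) (abs_time B ?t \<omega>) * f (btbs W B x ?t \<omega>) \<partial>M)"
        by (simp add: btbs_u_def)
      also have "\<dots> = (\<integral>\<omega>. (\<lambda>_. 1) (abs_time B ?t \<omega>) * \<phi> (\<Prod>i\<in>UNIV. abs_time B ?t \<omega> $ i) \<partial>M)"
        unfolding \<phi>_def by (rule expectation_btbs[OF procs ts _ _ c0 A]) auto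
      also have "\<dots> = (\<integral>\<omega>. (\<lambda>y. \<phi> (\<bar>snd y\<bar> * \<bar>fst y\<bar>)) (?Q j t \<omega>, B j s \<omega>) \<partial>M)"
        unfolding prodQ[of ?t _ j] Qs using Q0 by (simp add: vec_upd_def)
      also have "\<dots> = (\<integral>y. (\<lambda>y. \<phi> (\<bar>snd y\<bar> * \<bar>fst y\<bar>)) (fst y, sqrt s * snd y) \<partial>(?\<nu> \<Otimes>\<^sub>M std_gaussian))"
        by (rule expectation_other_times_motion[OF procs to s]) measurable
      finally show ?thesis using s by (simp add: abs_mult mult.assoc)
    qed
    note res = caputo_half_gaussian_mixture[OF nu nu_int abs_ge_zero phi psi deriv u tj]
    show "caputo_exists (1/2) (\<lambda>s. btbs_u M W B f (vec_upd t j s) x) (t $ j)" by (rule res(1))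
    \<comment> \<open>This writes \<open>?Q j t\<close> as a function of \<open>abs_time\<close>,
      the form of weight that \<open>expectation_btbs\<close> accepts.\<close>
    define F where "F v = (\<Prod>i\<in>UNIV - {j}. v $ i)" for v :: "real ^ 'n"
    have FQ: "F (abs_time B t \<omega>) = ?Q j t \<omega>" for \<omega>
      by (simp add: F_def abs_time_def other_times_def)
    have Fm: "F \<in> borel_measurable borel"
      unfolding F_def by (intro borel_measurable_continuous_onI continuous_intros)
    have "laplacian (btbs_V M W B f j t) x = (\<integral>\<omega>. F (abs_time B t \<omega>) * laplacian f (btbs W B x t \<omega>) \<partial>M)"
      unfolding V_lap[OF to] FQ ..
    also have "\<dots> = (\<integral>\<omega>. F (abs_time B t \<omega>) * \<psi> (\<Prod>i\<in>UNIV. abs_time B t \<omega> $ i) \<partial>M)"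
      unfolding \<psi>_def by (rule expectation_btbs[OF procs to Fm _ cL L]) (simp add: FQ Qi[OF to])
    also have "\<dots> = (\<integral>\<omega>. (\<lambda>y. \<psi> (\<bar>snd y\<bar> * \<bar>fst y\<bar>) * \<bar>fst y\<bar>) (?Q j t \<omega>, B j (t $ j) \<omega>) \<partial>M)"
      unfolding prodQ[of t _ j] FQ using Q0 by (simp add: mult.commute)
    also have "\<dots> = (\<integral>y. (\<lambda>y. \<psi> (\<bar>snd y\<bar> * \<bar>fst y\<bar>) * \<bar>fst y\<bar>) (fst y, sqrt (t $ j) * snd y) \<partial>(?\<nu> \<Otimes>\<^sub>M std_gaussian))"
      by (rule expectation_other_times_motion[OF procs to less_imp_le[OF tj]]) measurable
    also have "\<dots> = (\<integral>y. \<psi> (sqrt (t $ j) * (\<bar>snd y\<bar> * \<bar>fst y\<bar>)) * \<bar>fst y\<bar> \<partial>(?\<nu> \<Otimes>\<^sub>M std_gaussian))"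
      using tj by (simp add: abs_mult mult.assoc)
    finally show "caputo_deriv (1/2) (\<lambda>s. btbs_u M W B f (vec_upd t j s) x) (t $ j)
        = 1 / sqrt 8 * laplacian (btbs_V M W B f j t) x"
      using res(2) by simp
  qed
  have bdry: "btbs_u M W B f t x = f x" if t: "t \<in> orthant_boundary" for t x
  proof -
    from t obtain i where i: "t \<in> orthant" "t $ i = 0" by (auto simp: orthant_boundary_def)
    have "btbs_u M W B f t x = (\<integral>\<omega>. f x \<partial>M)"
      unfolding btbs_u_def
      by (intro Bochner_Integration.integral_cong refl) (simp add: btbs_boundary[OF procs i])
    then show ?thesis by (simp add: prob_space)
  qed
  have V_zero: "btbs_V M W B f j t x = 0" if "i \<in> UNIV - {j}" "t $ i = 0" for i j t x
  proof -
    have "btbs_V M W B f j t x = (\<integral>\<omega>. 0 \<partial>M)"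
      unfolding btbs_V_def
    proof (intro Bochner_Integration.integral_cong refl)
      fix \<omega> assume "\<omega> \<in> space M"
      then have "(\<Prod>i\<in>UNIV - {j}. \<bar>B i (t $ i) \<omega>\<bar>) = 0"
        using that motion_0[OF procs] by (intro prod_zero) (auto intro!: bexI[of _ i])
      then show "(\<Prod>i\<in>UNIV - {j}. \<bar>B i (t $ i) \<omega>\<bar>) * f (btbs W B x t \<omega>) = 0" by simp
    qed
    then show ?thesis by simp
  qed
  have V_init: "btbs_V M W B f j t x = (\<Prod>i\<in>UNIV - {j}. sqrt (2 / pi) * (t $ i) powr (1/2)) * f x"
    if t: "t \<in> orthant" "t $ j = 0" for j t x
  proof -
    have "btbs_V M W B f j t x = (\<integral>\<omega>. ?Q j t \<omega> * f x \<partial>M)"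
      unfolding btbs_V_def other_times_def
      by (intro Bochner_Integration.integral_cong refl) (simp add: btbs_boundary[OF procs t])
    then show ?thesis by (simp add: expectation_other_times[OF procs t(1)])
  qed
  have one: "(\<forall>j. \<forall>t\<in>orthant. \<forall>x. btbs_u M W B f t x = btbs_V M W B f j t x) \<and>
        (\<forall>t>0. \<forall>x.
            caputo_exists (1/2) (\<lambda>s. btbs_u M W B f (vec s) x) t \<and>
            second_partials_exist (btbs_u M W B f (vec t)) \<and>
            caputo_deriv (1/2) (\<lambda>s. btbs_u M W B f (vec s) x) t
              = 1 / sqrt 8 * laplacian (btbs_u M W B f (vec t)) x) \<and>
        (\<forall>x. btbs_u M W B f (vec 0) x = f x)" if card: "CARD('n) = 1"
  proof -
    obtain j :: 'n where j: "UNIV = {j}" using card by (auto simp: card_1_singleton_iff)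
    then have all: "k = j" for k by auto
    \<comment> \<open>With a single index the weight in \<open>btbs_V\<close> is an empty
      product.\<close>
    have uV: "btbs_u M W B f t = btbs_V M W B f k t" for k t
      using all[of k] by (simp add: btbs_u_def[abs_def] btbs_V_def[abs_def] j)
    have upd: "vec_upd (vec t) j s = (vec s :: real ^ 'n)" for t s
      using all by (simp add: vec_upd_def vec_eq_iff)
    have op: "vec t \<in> (open_orthant :: (real ^ 'n) set)" "vec t \<in> (orthant :: (real ^ 'n) set)" if "t > 0" for t
      using that by (simp_all add: open_orthant_def orthant_def)
    have v0: "vec 0 \<in> (orthant_boundary :: (real ^ 'n) set)" by (simp add: orthant_boundary_def orthant_def)
    have cap: "caputo_exists (1/2) (\<lambda>s. btbs_u M W B f (vec s) x) t"
      "second_partials_exist (btbs_u M W B f (vec t))"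
      "caputo_deriv (1/2) (\<lambda>s. btbs_u M W B f (vec s) x) t = 1 / sqrt 8 * laplacian (btbs_u M W B f (vec t)) x"
      if "t > 0" for t x
      using caputo[OF op(1)[OF that], of j x] V_ex[OF op(2)[OF that], of j]
      unfolding upd uV[of _ j, symmetric] by simp_all
    show ?thesis
      by (intro conjI allI ballI impI cap bdry[OF v0] fun_cong[OF uV])
  qed
  have int': "integrable M (\<lambda>\<omega>. (\<Prod>i\<in>UNIV - {j}. \<bar>B i (t $ i) \<omega>\<bar>) * f (btbs W B x t \<omega>))"
    if "t \<in> orthant" for t j x
    using intV[OF that c0 A] by (simp add: other_times_def btbs_eq)
  have oo: "t \<in> open_orthant \<Longrightarrow> t \<in> orthant" for t :: "real ^ 'n"
    by (auto simp: orthant_def open_orthant_def less_imp_le)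
  show ?thesis
  proof (rule conjI[OF _ conjI], goal_cases)
    case 1 show ?case by (intro ballI allI conjI int int')
  next
    case 2 show ?case
      by (intro allI ballI conjI impI caputo V_ex[OF oo] bdry V_init; (elim bexE V_zero)?)
  next
    case 3 show ?case by (rule impI, rule one)
  qed
qed

end
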